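(* Let $G$ be a $4$-chordal graph that contains no maximal $3$-clique. Unless $G$ has exactly $4$ vertices, $G$ has a clique transversal with at most $2(|G|-1)/7$ vertices, where $|G|$ is the number of vertices of $G$.
   Context: All graphs are finite and simple. A clique is a complete subgraph; a $k$-clique is a clique on $k$ vertices; a clique is non-trivial if it has at least $2$ vertices and maximal if it is inclusion-wise maximal among complete subgraphs. A graph is chordal if it has no induced cycle of length at least four; a chordal graph is $4$-chordal if every edge lies in a $4$-clique. A clique transversal of $G$ is a set of vertices meeting every non-trivial maximal clique of $G$. *)

theory Defs
  imports Complex_Main "Graph_Theory.Graph_Theory"
begin

text \<open>
  A finite simple graph is a \<^locale>\<open>pair_graph\<close>: each edge is represented by both of its orientations.
\<close>

definition clique :: "'a pair_pre_digraph \<Rightarrow> 'a set \<Rightarrow> bool" where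
  "clique G C \<longleftrightarrow> C \<subseteq> pverts G \<and> K\<^bsub>card C\<^esub> (with_proj G \<restriction> C)"

definition maximal_clique :: "'a pair_pre_digraph \<Rightarrow> 'a set \<Rightarrow> bool" where
  "maximal_clique G C \<longleftrightarrow> clique G C \<and> (\<forall>D. clique G D \<and> C \<subseteq> D \<longrightarrow> D = C)"

text \<open>
  A cycle \<open>p\<close> is the list of arcs met when walking once around it, so \<open>fst ` set p\<close> is its vertex set
  and \<open>set p \<union> (set p)\<inverse>\<close> consists of both orientations of its edges.
  The walk along a single edge and back also counts as a cycle here, but it has length 2.
\<close>

definition induced_cycle :: "'a pair_pre_digraph \<Rightarrow> ('a \<times> 'a) awalk \<Rightarrow> bool" where
  "induced_cycle G p \<longleftrightarrow> pre_digraph.cycle (with_proj G) p \<and>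
     arcs (with_proj G \<restriction> (fst ` set p)) = set p \<union> (set p)\<inverse>"

definition chordal :: "'a pair_pre_digraph \<Rightarrow> bool" where
  "chordal G \<longleftrightarrow> \<not> (\<exists>p. induced_cycle G p \<and> length p \<ge> 4)"

definition four_chordal :: "'a pair_pre_digraph \<Rightarrow> bool" where
  "four_chordal G \<longleftrightarrow> chordal G \<and>
     (\<forall>(u, v) \<in> parcs G. \<exists>C. clique G C \<and> card C = 4 \<and> u \<in> C \<and> v \<in> C)"

definition clique_transversal :: "'a pair_pre_digraph \<Rightarrow> 'a set \<Rightarrow> bool" where
  "clique_transversal G T \<longleftrightarrow> T \<subseteq> pverts G \<and>
     (\<forall>C. maximal_clique G C \<and> card C \<ge> 2 \<longrightarrow> T \<inter> C \<noteq> {})"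

end

theory Submission
  imports Defs
begin

text \<open>
  A simplicial vertex \<open>v\<close> of a maximal clique \<open>C\<close> with at least four vertices may be deleted if instead
  some three other vertices of \<open>C\<close> are required to be hit: a set hitting the triple hits \<open>C\<close>.
  Likewise, a vertex that lies in no other requirement than a demanded triple may be deleted if the rest
  of the triple becomes a demanded pair. So one bounds the number of vertices that hit
  all maximal cliques with at least four vertices of a chordal graph together with given triples and
  pairs, by induction on the number of vertices. With \<open>n\<close> vertices, \<open>t\<close> triples and \<open>p\<close> pairs the
  bound is \<open>p + (2 * N - 2) / 7\<close> where \<open>N = n + t - 2 * p\<close>, up to small cases.

  In a minimal counterexample the pairs are disjoint from all other demands and no vertex lies in three
  triples. Call a vertex free if every large maximal clique through it contains a demand. A free vertex
  lies in exactly two triples, and these share nothing else. A simplicial vertex \<open>v\<close> of the subgraph of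
  non-free vertices lies in only one maximal clique without a demand, and in a triple with a free vertex,
  which allows a reduction that decreases \<open>N\<close> by 7 and uses up 2 vertices.

  This reduction is not good enough if \<open>N\<close> is 7 or 11. Then there are at most four triples, and a few
  free vertices inducing a connected subgraph hit all of them. By a theorem of Dirac, some simplicial
  vertex is not adjacent to any of these, unless they meet all maximal cliques, but such a vertex must
  lie in another triple. The one configuration that escapes this argument consists of two pairs of
  triples, each with a common free vertex; there two suitable vertices hit all triples and the only
  clique without a demand.
\<close>

lemma in_zip_tl_iff:
  "(x, y) \<in> set (zip ws (tl ws)) \<longleftrightarrow> (\<exists>us vs. ws = us @ x # y # vs)"
proof (induction ws)
  case Nil
  show ?case by simp
next
  case (Cons w ws)
  show ?case
  proof (cases ws)
    case Nil
    then show ?thesis by (auto simp: Cons_eq_append_conv)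
  next
    case (Cons w' ws')
    have "(\<exists>us vs. w # ws = us @ x # y # vs) \<longleftrightarrow> (x = w \<and> y = w') \<or> (\<exists>us vs. ws = us @ x # y # vs)"
      using Cons by (auto simp: Cons_eq_append_conv)
    then show ?thesis using Cons.IH Cons by auto
  qed
qed

section \<open>Simplicial vertices of chordal graphs\<close>

locale simple_graph =
  fixes adj :: "'a \<Rightarrow> 'a \<Rightarrow> bool"
  assumes sym: "adj x y \<Longrightarrow> adj y x"
    and irrefl: "\<not> adj x x"
begin

definition conn :: "'a set \<Rightarrow> bool" where
  "conn A \<longleftrightarrow> A \<noteq> {} \<and> (\<forall>x\<in>A. \<forall>y\<in>A. (x, y) \<in> {(u, v). u \<in> A \<and> v \<in> A \<and> adj u v}\<^sup>*)"

lemma walk_in_conn: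
  assumes "conn P" "p \<in> P" "p' \<in> P"
  shows "\<exists>ws. ws \<noteq> [] \<and> hd ws = p \<and> last ws = p' \<and> set ws \<subseteq> P \<and> successively adj ws"
proof -
  have "(p, p') \<in> {(u, v). u \<in> P \<and> v \<in> P \<and> adj u v}\<^sup>*"
    using assms by (auto simp: conn_def)
  then show ?thesis
  proof (induction rule: rtrancl_induct)
    case base
    show ?case using assms by (intro exI[of _ "[p]"]) auto
  next
    case (step y z)
    then obtain ws where "ws \<noteq> []" "hd ws = p" "last ws = y" "set ws \<subseteq> P" "successively adj ws"
      by blast
    with step show ?case
      by (intro exI[of _ "ws @ [z]"]) (auto simp: successively_append_iff)
  qed
qed

text \<open>A shortest walk through \<open>P\<close> is an induced path.\<close>

lemma induced_path:
  assumes "conn P" "p \<in> P" "p' \<in> P" "adj s p" "adj s' p'" "s \<noteq> s'" "\<not> adj s s'"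
  obtains xs where "xs \<noteq> []" "distinct (s # xs @ [s'])" "set xs \<subseteq> P"
    "\<And>x y. x \<in> set (s # xs @ [s']) \<Longrightarrow> y \<in> set (s # xs @ [s']) \<Longrightarrow>
       adj x y \<longleftrightarrow> (x, y) \<in> set (zip (s # xs) (xs @ [s'])) \<union> (set (zip (s # xs) (xs @ [s'])))\<inverse>"
proof -
  define walk where "walk ws \<longleftrightarrow> ws \<noteq> [] \<and> hd ws = s \<and> last ws = s' \<and>
    set ws \<subseteq> insert s (insert s' P) \<and> successively adj ws" for ws
  obtain w0 where w0: "w0 \<noteq> []" "hd w0 = p" "last w0 = p'" "set w0 \<subseteq> P" "successively adj w0"
    using walk_in_conn[OF assms(1-3)] by blast
  have "walk (s # w0 @ [s'])"
    using w0 assms sym by (auto simp: walk_def successively_append_iff successively_Cons)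
  then obtain ws where ws: "walk ws" and min: "\<And>ws'. walk ws' \<Longrightarrow> length ws \<le> length ws'"
    using ex_has_least_nat[of walk _ length] by blast
  have chord: "vs = []" if "ws = us @ x # vs @ y # zs" "adj x y" for us vs zs x y
  proof -
    have "walk (us @ x # y # zs)"
      using ws that by (auto simp: walk_def successively_append_iff successively_Cons hd_append
          split: if_splits)
    from min[OF this] show ?thesis using that by simp
  qed
  have dist: "distinct ws"
  proof (rule ccontr)
    assume "\<not> distinct ws"
    then obtain us vs zs x where e: "ws = us @ [x] @ vs @ [x] @ zs"
      using not_distinct_decomp by blast
    have "walk (us @ x # zs)"
      using ws e by (auto simp: walk_def successively_append_iff successively_Cons hd_append
          split: if_splits)
    from min[OF this] show False using e by simp
  qed
  obtain xs where xs: "ws = s # xs @ [s']"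
  proof -
    obtain us where "ws = s # us" using ws by (cases ws) (auto simp: walk_def)
    moreover have "us \<noteq> []" using ws assms(6) calculation by (auto simp: walk_def)
    ultimately show thesis using ws that[of "butlast us"]
      by (auto simp: walk_def split: if_splits)
  qed
  have arcs: "(x, y) \<in> set (zip (s # xs) (xs @ [s'])) \<longleftrightarrow> (\<exists>us vs. ws = us @ x # y # vs)" for x y
  proof -
    have "zip ws (tl ws) = zip (s # xs) (xs @ [s'])"
      unfolding xs using zip_append1[of "s # xs" "[s']" "xs @ [s']"] by simp
    then show ?thesis using in_zip_tl_iff[of x y ws] by simp
  qed
  show thesis
  proof (rule that[of xs])
    show "xs \<noteq> []" using ws assms(7) by (auto simp: walk_def xs)
    show "distinct (s # xs @ [s'])" using dist xs by simp
    show "set xs \<subseteq> P" using ws dist by (auto simp: walk_def xs)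
    fix x y assume xy: "x \<in> set (s # xs @ [s'])" "y \<in> set (s # xs @ [s'])"
    have *: "\<exists>us vs. ws = us @ x # y # vs \<or> ws = us @ y # x # vs" if a: "adj x y"
    proof -
      obtain us vs where 1: "ws = us @ x # vs" using xy xs by (metis split_list)
      have "y \<noteq> x" using a irrefl by auto
      then consider "y \<in> set us" | "y \<in> set vs" using xy xs 1 by fastforce
      then show ?thesis
      proof cases
        case 1
        then obtain u1 u2 where "us = u1 @ y # u2" by (metis split_list)
        then have "ws = u1 @ y # u2 @ x # vs" using \<open>ws = us @ x # vs\<close> by simp
        moreover from chord[OF this sym[OF a]] have "u2 = []" .
        ultimately show ?thesis by auto
      next
        case 2
        then obtain u1 u2 where "vs = u1 @ y # u2" by (metis split_list)
        then have "ws = us @ x # u1 @ y # u2" using \<open>ws = us @ x # vs\<close> by simp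
        moreover from chord[OF this a] have "u1 = []" .
        ultimately show ?thesis by auto
      qed
    qed
    have **: "adj x y" if "ws = us @ x # y # vs" for us vs x y
      using ws that by (auto simp: walk_def successively_append_iff successively_Cons)
    show "adj x y \<longleftrightarrow> (x, y) \<in> set (zip (s # xs) (xs @ [s'])) \<union> (set (zip (s # xs) (xs @ [s'])))\<inverse>"
      unfolding Un_iff converse_iff arcs using * ** sym by metis
  qed
qed

text \<open>Induced paths from \<open>s\<close> to \<open>s'\<close> through \<open>P\<close> and
  through \<open>Q\<close> close up to a cycle: chords are ruled out since there are no edges
  between \<open>P\<close> and \<open>Q\<close> or between \<open>s\<close> and \<open>s'\<close>,
  and an inner vertex on each path gives length at least 4.\<close>

lemma induced_hole:
  assumes "conn P" "conn Q" "\<And>x y. x \<in> P \<Longrightarrow> y \<in> Q \<Longrightarrow> x \<noteq> y \<and> \<not> adj x y"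
    and "s \<notin> P \<union> Q" "s' \<notin> P \<union> Q" "s \<noteq> s'" "\<not> adj s s'"
    and "p \<in> P" "adj s p" "p' \<in> P" "adj s' p'" "q \<in> Q" "adj s q" "q' \<in> Q" "adj s' q'"
  obtains z zs where "distinct (z # zs)" "3 \<le> length zs"
    "\<And>x y. x \<in> set (z # zs) \<Longrightarrow> y \<in> set (z # zs) \<Longrightarrow>
       adj x y \<longleftrightarrow> (x, y) \<in> set (zip (z # zs) (zs @ [z])) \<union> (set (zip (z # zs) (zs @ [z])))\<inverse>"
proof -
  obtain xs where xs: "xs \<noteq> []" "distinct (s # xs @ [s'])" "set xs \<subseteq> P"
    "\<And>x y. x \<in> set (s # xs @ [s']) \<Longrightarrow> y \<in> set (s # xs @ [s']) \<Longrightarrow>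
       adj x y \<longleftrightarrow> (x, y) \<in> set (zip (s # xs) (xs @ [s'])) \<union> (set (zip (s # xs) (xs @ [s'])))\<inverse>"
    using induced_path[of P p p' s s'] assms by metis
  obtain ys where ys: "ys \<noteq> []" "distinct (s # ys @ [s'])" "set ys \<subseteq> Q"
    "\<And>x y. x \<in> set (s # ys @ [s']) \<Longrightarrow> y \<in> set (s # ys @ [s']) \<Longrightarrow>
       adj x y \<longleftrightarrow> (x, y) \<in> set (zip (s # ys) (ys @ [s'])) \<union> (set (zip (s # ys) (ys @ [s'])))\<inverse>"
    using induced_path[of Q q q' s s'] assms by metis
  let ?zs = "xs @ s' # rev ys"
  \<comment> \<open>The path through \<open>Q\<close> is walked backwards, so its arcs appear
    reversed.\<close>
  have "zip (s' # rev ys) (rev ys @ [s]) = rev (zip (ys @ [s']) (s # ys))"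
    by (subst zip_rev[symmetric]) simp_all
  then have "set (zip (s' # rev ys) (rev ys @ [s])) = (set (zip (s # ys) (ys @ [s'])))\<inverse>"
    by (auto simp: in_set_zip)
  moreover have "zip (s # ?zs) (?zs @ [s]) = zip (s # xs) (xs @ [s']) @ zip (s' # rev ys) (rev ys @ [s])"
    using zip_append[of "s # xs" "xs @ [s']" "s' # rev ys" "rev ys @ [s]"] by simp
  ultimately have arcs: "set (zip (s # ?zs) (?zs @ [s])) =
      set (zip (s # xs) (xs @ [s'])) \<union> (set (zip (s # ys) (ys @ [s'])))\<inverse>"
    by simp
  have inx: "x \<in> set (s # xs @ [s']) \<and> y \<in> set (s # xs @ [s'])"
    if "(x, y) \<in> set (zip (s # xs) (xs @ [s']))" for x y
    using set_zip_leftD[OF that] set_zip_rightD[OF that] by auto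
  have iny: "x \<in> set (s # ys @ [s']) \<and> y \<in> set (s # ys @ [s'])"
    if "(x, y) \<in> set (zip (s # ys) (ys @ [s']))" for x y
    using set_zip_leftD[OF that] set_zip_rightD[OF that] by auto
  show thesis
  proof (rule that[of s ?zs])
    show "distinct (s # ?zs)" using xs(2,3) ys(2,3) assms(3) by auto
    show "3 \<le> length ?zs" using xs(1) ys(1) by (cases xs; cases ys) auto
    fix x y assume xy: "x \<in> set (s # ?zs)" "y \<in> set (s # ?zs)"
    show "adj x y \<longleftrightarrow> (x, y) \<in> set (zip (s # ?zs) (?zs @ [s])) \<union> (set (zip (s # ?zs) (?zs @ [s])))\<inverse>"
    proof
      assume a: "adj x y"
      have "(x \<in> set (s # xs @ [s']) \<and> y \<in> set (s # xs @ [s'])) \<or> (x \<in> set (s # ys @ [s']) \<and> y \<in> set (s # ys @ [s']))"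
        using xy a assms(3) sym xs(3) ys(3) by auto blast+
      then show "(x, y) \<in> set (zip (s # ?zs) (?zs @ [s])) \<union> (set (zip (s # ?zs) (?zs @ [s])))\<inverse>"
        using xs(4)[of x y] ys(4)[of x y] a unfolding arcs by blast
    next
      assume "(x, y) \<in> set (zip (s # ?zs) (?zs @ [s])) \<union> (set (zip (s # ?zs) (?zs @ [s])))\<inverse>"
      then show "adj x y"
        using xs(4)[of x y] ys(4)[of x y] inx iny unfolding arcs by blast
    qed
  qed
qed

end

text \<open>
  The form in which chordality is used: two disjoint connected sets without edges between them have
  only a clique of common neighbours.
\<close>

locale hole_free_graph = simple_graph adj for adj :: "'a \<Rightarrow> 'a \<Rightarrow> bool" +
  assumes no_hole: "\<lbrakk>conn P; conn Q; \<And>x y. x \<in> P \<Longrightarrow> y \<in> Q \<Longrightarrow> x \<noteq> y \<and> \<not> adj x y;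
      s \<notin> P \<union> Q; s' \<notin> P \<union> Q; s \<noteq> s'; p \<in> P; adj s p; p' \<in> P; adj s' p';
      q \<in> Q; adj s q; q' \<in> Q; adj s' q'\<rbrakk> \<Longrightarrow> adj s s'"

section \<open>From chordal graphs to hole-free graphs\<close>

lemma pawalk_verts_zip: "pawalk_verts x (zip (x # l) (l @ [z])) = x # l @ [z]"
  by (induction l arbitrary: x) auto

lemma pcas_zip: "pcas x (zip (x # l) (l @ [z])) z"
  by (induction l arbitrary: x) auto

lemma (in pair_graph) simple_graph_parcs: "simple_graph (\<lambda>x y. (x, y) \<in> parcs G)"
proof
  show "(y, x) \<in> parcs G" if "(x, y) \<in> parcs G" for x y
    using that by (rule arcs_symmetric)
  show "(x, x) \<notin> parcs G" for x
    using no_loops' by blast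
qed

lemma (in pair_graph) chordal_imp_hole_free:
  assumes "chordal G"
  shows "hole_free_graph (\<lambda>x y. (x, y) \<in> parcs G)"
proof -
  interpret s: simple_graph "\<lambda>x y. (x, y) \<in> parcs G"
    by (rule simple_graph_parcs)
  show ?thesis
  proof unfold_locales
    fix P Q s s' p p' q q'
    assume *: "s.conn P" "s.conn Q" "\<And>x y. x \<in> P \<Longrightarrow> y \<in> Q \<Longrightarrow> x \<noteq> y \<and> (x, y) \<notin> parcs G"
      "s \<notin> P \<union> Q" "s' \<notin> P \<union> Q" "s \<noteq> s'" "p \<in> P" "(s, p) \<in> parcs G" "p' \<in> P" "(s', p') \<in> parcs G"
      "q \<in> Q" "(s, q) \<in> parcs G" "q' \<in> Q" "(s', q') \<in> parcs G"
    show "(s, s') \<in> parcs G"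
    proof (rule ccontr)
      assume n: "(s, s') \<notin> parcs G"
      from s.induced_hole[OF *(1-6) n *(7-14)]
      obtain z zs where z: "distinct (z # zs)" "3 \<le> length zs"
        "\<And>x y. x \<in> set (z # zs) \<Longrightarrow> y \<in> set (z # zs) \<Longrightarrow> (x, y) \<in> parcs G \<longleftrightarrow>
           (x, y) \<in> set (zip (z # zs) (zs @ [z])) \<union> (set (zip (z # zs) (zs @ [z])))\<inverse>"
        by blast
      let ?p = "zip (z # zs) (zs @ [z])"
      have ends: "x \<in> set (z # zs) \<and> y \<in> set (z # zs)" if "(x, y) \<in> set ?p" for x y
        using set_zip_leftD[OF that] set_zip_rightD[OF that] by auto
      have sub: "set ?p \<subseteq> parcs G" using z(3) ends by (auto simp del: zip_Cons_Cons)
      have fstp: "fst ` set ?p = set (z # zs)"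
        by (subst set_map[symmetric], subst map_fst_zip) auto
      have "(z, hd (zs @ [z])) \<in> parcs G" using sub by (cases zs) auto
      then have "z \<in> pverts G" by (rule in_arcsD1)
      then have "pre_digraph.cycle (with_proj G) ?p"
        using sub z(1) pcas_zip[of z zs z] pawalk_verts_zip[of z zs z]
        unfolding pre_digraph.cycle_def pre_digraph.awalk_def
        by (intro exI[of _ z]) (auto simp: cas_with_proj_eq awalk_verts_with_proj_eq simp del: zip_Cons_Cons pcas.simps pawalk_verts.simps)
      moreover have "arcs (with_proj G \<restriction> (fst ` set ?p)) = set ?p \<union> (set ?p)\<inverse>"
      proof -
        have "arcs (with_proj G \<restriction> (set (z # zs))) = {e \<in> parcs G. fst e \<in> set (z # zs) \<and> snd e \<in> set (z # zs)}"
          by simp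
        also have "\<dots> = set ?p \<union> (set ?p)\<inverse>"
          using z(3) ends by (auto simp del: zip_Cons_Cons set_simps) 
        finally show ?thesis unfolding fstp .
      qed
      ultimately have "induced_cycle G ?p" by (simp add: induced_cycle_def)
      moreover have "4 \<le> length ?p" using z(2) by simp
      ultimately show False using assms unfolding chordal_def by blast
    qed
  qed
qed

context simple_graph
begin

definition clq :: "'a set \<Rightarrow> bool" where
  "clq K \<longleftrightarrow> (\<forall>x\<in>K. \<forall>y\<in>K. x \<noteq> y \<longrightarrow> adj x y)"

definition simplicial :: "'a set \<Rightarrow> 'a \<Rightarrow> bool" where
  "simplicial U z \<longleftrightarrow> z \<in> U \<and> clq {y \<in> U. adj z y}"

lemma adj_commute: "adj x y \<longleftrightarrow> adj y x"
  using sym by blast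

lemma clq_subset: "clq K \<Longrightarrow> L \<subseteq> K \<Longrightarrow> clq L"
  by (auto simp: clq_def)

lemma clq_insert:
  assumes "clq K" "\<And>w. w \<in> K \<Longrightarrow> adj v w"
  shows "clq (insert v K)"
  unfolding clq_def
proof (intro ballI impI)
  fix x y assume xy: "x \<in> insert v K" "y \<in> insert v K" "x \<noteq> y"
  show "adj x y"
  proof (cases "y = v")
    case True
    then show ?thesis using xy assms(2)[of x] sym[of v x] by auto
  next
    case False
    then show ?thesis using xy assms by (auto simp: clq_def)
  qed
qed

lemma simplicial_subset: "simplicial U z \<Longrightarrow> W \<subseteq> U \<Longrightarrow> z \<in> W \<Longrightarrow> simplicial W z"
  by (auto simp: simplicial_def intro: clq_subset)

lemma conn_singleton: "conn {x}"
  by (simp add: conn_def)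

lemma conn_nonempty: "conn A \<Longrightarrow> A \<noteq> {}"
  by (simp add: conn_def)

lemma conn_insert:
  assumes "conn A" "a \<in> A" "adj a x"
  shows "conn (insert x A)"
proof -
  let ?r = "{(u, v). u \<in> insert x A \<and> v \<in> insert x A \<and> adj u v}"
  have r: "(y, z) \<in> ?r\<^sup>*" if "y \<in> A" "z \<in> A" for y z
    using assms(1) that rtrancl_mono[of "{(u, v). u \<in> A \<and> v \<in> A \<and> adj u v}" ?r]
    by (auto simp: conn_def)
  have "(y, x) \<in> ?r\<^sup>*" "(x, y) \<in> ?r\<^sup>*" if "y \<in> A" for y
  proof -
    have "(a, x) \<in> ?r" "(x, a) \<in> ?r" using assms sym by auto
    with r[OF that assms(2)] r[OF assms(2) that] show "(y, x) \<in> ?r\<^sup>*" "(x, y) \<in> ?r\<^sup>*"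
      by (auto intro: rtrancl_into_rtrancl converse_rtrancl_into_rtrancl)
  qed
  with r show ?thesis by (auto simp: conn_def)
qed

text \<open>The closure is reflexive, so the value is \<open>{x}\<close> for \<open>x\<close>
  outside \<open>U\<close>; hence the hypothesis \<open>x \<in> U\<close> in
  \<open>component_subset\<close>.\<close>

definition component :: "'a set \<Rightarrow> 'a \<Rightarrow> 'a set" where
  "component U x = {y. (x, y) \<in> {(u, v). u \<in> U \<and> v \<in> U \<and> adj u v}\<^sup>*}"

lemma component_self: "x \<in> component U x"
  by (simp add: component_def)

lemma component_subset: "x \<in> U \<Longrightarrow> component U x \<subseteq> U"
  by (auto simp: component_def elim: rtranclE)

lemma component_closed: "x \<in> U \<Longrightarrow> y \<in> component U x \<Longrightarrow> adj y z \<Longrightarrow> z \<in> U \<Longrightarrow> z \<in> component U x"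
  using component_subset[of x U] by (auto simp: component_def intro: rtrancl_into_rtrancl)

lemma conn_component: "conn (component U x)"
proof -
  let ?r = "{(u, v). u \<in> U \<and> v \<in> U \<and> adj u v}"
  let ?q = "{(u, v). u \<in> component U x \<and> v \<in> component U x \<and> adj u v}"
  have q: "(x, y) \<in> ?q\<^sup>*" if "(x, y) \<in> ?r\<^sup>*" for y
    using that
  proof (induction rule: rtrancl_induct)
    case (step y z)
    then have "(y, z) \<in> ?q" by (auto simp: component_def intro: rtrancl_into_rtrancl)
    with step show ?case by (meson rtrancl_into_rtrancl)
  qed simp
  have "sym (?q\<^sup>*)" by (intro sym_rtrancl symI) (auto intro: sym)
  then show ?thesis
    using q component_self[of x U] unfolding conn_def component_def
    by (auto dest: symD intro: rtrancl_trans)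
qed

end

section \<open>Dirac's theorem on simplicial vertices\<close>

context hole_free_graph
begin

text \<open>Among the vertices away from \<open>A\<close> take the component \<open>B\<close> of
  \<open>x\<close>, with boundary \<open>S\<close>. Vertices of \<open>S\<close> have neighbours in
  both \<open>A\<close> and \<open>B\<close>, so \<open>S\<close> is a clique by
  \<open>no_hole\<close>. Neighbours of a vertex of \<open>B\<close> lie in
  \<open>B \<union> S\<close>, so it suffices to find a simplicial vertex of this smaller set inside
  \<open>B\<close>.\<close>

lemma simplicial_far:
  assumes "finite U" "A \<subseteq> U" "conn A" "x \<in> U" "x \<notin> A" "\<And>a. a \<in> A \<Longrightarrow> \<not> adj x a"
  shows "\<exists>z. simplicial U z \<and> z \<notin> A \<and> (\<forall>a\<in>A. \<not> adj z a)"
  using assms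
proof (induction "card U" arbitrary: U A x rule: less_induct)
  case less
  define U0 where "U0 = {y \<in> U. y \<notin> A \<and> (\<forall>a\<in>A. \<not> adj y a)}"
  define B where "B = component U0 x"
  define S where "S = {s \<in> U - B. \<exists>b\<in>B. adj s b}"
  have xU0: "x \<in> U0" using less.prems by (auto simp: U0_def)
  have BU0: "B \<subseteq> U0" unfolding B_def using xU0 by (rule component_subset)
  have SU0: "S \<inter> U0 = {}"
    using component_closed[OF xU0] adj_commute by (auto simp: S_def B_def)
  have SA: "s \<notin> A" if "s \<in> S" for s
  proof
    assume "s \<in> A"
    obtain b where "b \<in> B" "adj s b" using \<open>s \<in> S\<close> by (auto simp: S_def)
    then show False using \<open>s \<in> A\<close> BU0 sym[of s b] by (auto simp: U0_def)
  qed
  have Snb: "\<exists>a\<in>A. adj s a" if "s \<in> S" for s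
  proof -
    have "s \<notin> U0" "s \<in> U" using that SU0 by (auto simp: S_def)
    then show ?thesis using SA[OF that] by (auto simp: U0_def)
  qed
  have S: "clq S"
    unfolding clq_def
  proof (intro ballI impI)
    fix s s' assume s: "s \<in> S" "s' \<in> S" "s \<noteq> s'"
    obtain a a' where "a \<in> A" "adj s a" "a' \<in> A" "adj s' a'" using Snb s by blast
    moreover obtain b b' where "b \<in> B" "adj s b" "b' \<in> B" "adj s' b'" using s by (auto simp: S_def)
    moreover have "y \<noteq> z \<and> \<not> adj y z" if "y \<in> A" "z \<in> B" for y z
    proof -
      have "z \<in> U0" using that BU0 by auto
      then show ?thesis using that sym[of y z] by (auto simp: U0_def)
    qed
    moreover have "conn B" by (simp add: B_def conn_component)
    moreover have "s \<notin> A \<union> B" "s' \<notin> A \<union> B" using s SA by (auto simp: S_def)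
    ultimately show "adj s s'" using no_hole[of A B s s' a a' b b'] less.prems(3) s(3) by blast
  qed
  let ?H = "B \<union> S"
  have BU: "B \<subseteq> U" and disj: "B \<inter> A = {}" using BU0 by (auto simp: U0_def)
  have HU: "?H \<subseteq> U" using BU by (auto simp: S_def)
  have "A \<inter> ?H = {}" using disj SA by auto
  with conn_nonempty[OF less.prems(3)] less.prems(2) HU have HU': "?H \<subset> U" by blast
  have fin: "finite ?H" "finite B" using HU BU less.prems(1) by (auto intro: finite_subset)
  have cH: "card ?H < card U" using HU' less.prems(1) by (simp add: psubset_card_mono)
  have cB: "card B < card U" using card_mono[OF fin(1), of B] cH by simp
  have "\<exists>z\<in>B. simplicial ?H z"
  \<comment> \<open>If vertices of \<open>S\<close> are adjacent to all others of \<open>?H\<close>,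
    a simplicial vertex of \<open>B\<close> serves. Otherwise induction with one vertex of
    \<open>S\<close> as connected set gives a \<open>z\<close> not adjacent to it, which cannot lie
    in the clique \<open>S\<close>.\<close>
  proof (cases "\<forall>s\<in>S. \<forall>y\<in>?H. y \<noteq> s \<longrightarrow> adj s y")
    case True
    have "\<exists>z. simplicial B z"
    proof (cases "clq B")
      case True
      then show ?thesis using component_self[of x U0]
        by (intro exI[of _ x]) (auto simp: simplicial_def B_def intro: clq_subset)
    next
      case False
      then obtain u v where uv: "u \<in> B" "v \<in> B" "u \<noteq> v" "\<not> adj u v" by (auto simp: clq_def)
      with less.hyps[OF cB fin(2), of "{v}" u] show ?thesis by (auto simp: conn_singleton)
    qed
    then obtain z where z: "simplicial B z" by blast
    have "clq {y \<in> ?H. adj z y}"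
      unfolding clq_def
    proof (intro ballI impI)
      fix p q assume "p \<in> {y \<in> ?H. adj z y}" "q \<in> {y \<in> ?H. adj z y}" "p \<noteq> q"
      then consider "p \<in> S" | "q \<in> S" | "p \<in> {y \<in> B. adj z y}" "q \<in> {y \<in> B. adj z y}" by blast
      then show "adj p q"
      proof cases
        case 1
        then show ?thesis using True \<open>q \<in> {y \<in> ?H. adj z y}\<close> \<open>p \<noteq> q\<close> by auto
      next
        case 2
        then have "adj q p" using True \<open>p \<in> {y \<in> ?H. adj z y}\<close> \<open>p \<noteq> q\<close> by auto
        then show ?thesis by (rule sym)
      next
        case 3
        then show ?thesis using z \<open>p \<noteq> q\<close> unfolding simplicial_def clq_def by blast
      qed
    qed
    then show ?thesis using z by (auto simp: simplicial_def)
  next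
    case False
    then obtain s y where sy: "s \<in> S" "y \<in> ?H" "y \<noteq> s" "\<not> adj s y" by blast
    have "\<exists>z. simplicial ?H z \<and> z \<notin> {s} \<and> (\<forall>a\<in>{s}. \<not> adj z a)"
      using less.hyps[OF cH fin(1), of "{s}" y] sy adj_commute by (auto simp: conn_singleton)
    then obtain z where "simplicial ?H z" "z \<noteq> s" "\<not> adj z s" by auto
    then show ?thesis using S sy(1) by (auto simp: simplicial_def clq_def)
  qed
  then obtain z where z: "z \<in> B" "simplicial ?H z" by blast
  have "{y \<in> U. adj z y} \<subseteq> {y \<in> ?H. adj z y}" using z(1) adj_commute by (auto simp: S_def)
  then have "simplicial U z"
    using z BU by (auto simp: simplicial_def intro: clq_subset)
  then show ?case using z(1) BU0 by (auto simp: U0_def)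
qed

lemma simplicial_exists:
  assumes "finite U" "U \<noteq> {}"
  shows "\<exists>z. simplicial U z"
proof (cases "clq U")
  case True
  then show ?thesis using assms by (auto simp: simplicial_def intro: clq_subset)
next
  case False
  then obtain u v where "u \<in> U" "v \<in> U" "u \<noteq> v" "\<not> adj u v" by (auto simp: clq_def)
  with simplicial_far[OF assms(1), of "{v}" u] show ?thesis by (auto simp: conn_singleton)
qed

text \<open>A vertex \<open>a\<close> of \<open>A\<close> with most neighbours in \<open>M\<close>
  works. If it missed \<open>m\<close>, a walk in \<open>A\<close> would lead from \<open>a\<close>
  through non-neighbours of \<open>m\<close> to a neighbour \<open>c\<close> of \<open>m\<close>. By
  \<open>no_hole\<close>, all neighbours of \<open>a\<close> in \<open>M\<close> are adjacent to
  \<open>c\<close>, which also has \<open>m\<close> and so beats \<open>a\<close>.\<close>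

lemma common_neighbour:
  assumes "finite M" "clq M" "conn A" "M \<inter> A = {}" "\<And>m. m \<in> M \<Longrightarrow> \<exists>a\<in>A. adj m a"
  shows "\<exists>a\<in>A. \<forall>m\<in>M. adj m a"
proof -
  define f where "f a = card {m \<in> M. adj m a}" for a
  obtain a0 where a0: "a0 \<in> A" using conn_nonempty[OF assms(3)] by blast
  have "f a' \<le> card M" for a' using assms(1) by (auto simp: f_def intro: card_mono)
  then have "\<exists>a. a \<in> A \<and> (\<forall>a'. a' \<in> A \<longrightarrow> f a' \<le> f a)"
    using a0 by (intro ex_has_greatest_nat[of _ a0 _ "Suc (card M)"]) (simp_all add: less_Suc_eq_le)
  then obtain a where a: "a \<in> A" "\<And>a'. a' \<in> A \<Longrightarrow> f a' \<le> f a" by blast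
  show ?thesis
  proof (rule ccontr)
    assume "\<not> ?thesis"
    then obtain m where m: "m \<in> M" "\<not> adj m a" using a(1) by blast
    let ?U = "{y \<in> A. \<not> adj m y}"
    let ?B = "component ?U a"
    have aU: "a \<in> ?U" using a m by auto
    have BU: "?B \<subseteq> ?U" using aU by (rule component_subset)
    have "\<exists>y\<in>?B. \<exists>c\<in>A. adj y c \<and> adj m c"
    proof (rule ccontr)
      assume n: "\<not> ?thesis"
      obtain c where c: "c \<in> A" "adj m c" using assms(5) m by blast
      have "(a, c) \<in> {(u, v). u \<in> A \<and> v \<in> A \<and> adj u v}\<^sup>*"
        using assms(3) a(1) c(1) by (auto simp: conn_def)
      then have "c \<in> ?B"
      proof (induction rule: rtrancl_induct)
        case (step y z)
        then have "z \<in> ?U" using n by auto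
        with step show ?case using component_closed[OF aU, of y z] by simp
      qed (rule component_self)
      then show False using BU c by auto
    qed
    then obtain b c where bc: "b \<in> ?B" "c \<in> A" "adj b c" "adj m c" by blast
    have "adj m' c" if m': "m' \<in> M" "adj m' a" for m'
    proof -
      have "m' \<noteq> m" using m m' by auto
      moreover have "m' \<notin> A" "m \<notin> A" using m m' assms(4) by auto
      moreover have "adj m' m" using m m' \<open>m' \<noteq> m\<close> assms(2) by (auto simp: clq_def)
      moreover have "c \<notin> ?B" using BU bc by auto
      moreover have "c \<noteq> m" "m' \<noteq> c" using \<open>m \<notin> A\<close> \<open>m' \<notin> A\<close> bc by auto
      moreover have "m' \<notin> ?B" using BU \<open>m' \<notin> A\<close> by auto
      moreover have "m \<noteq> y \<and> \<not> adj m y" if "y \<in> ?B" for y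
      proof -
        have "y \<in> ?U" using that BU by (rule subsetD[rotated])
        then show ?thesis using \<open>m \<notin> A\<close> by auto
      qed
      ultimately show ?thesis
        by (intro no_hole[OF conn_singleton[of m] conn_component[of ?U a], of m' c m m a b])
          (use bc m' component_self[of a ?U] sym[OF bc(3)] sym[OF bc(4)] in simp_all)
    qed
    then have "insert m {m' \<in> M. adj m' a} \<subseteq> {m' \<in> M. adj m' c}" using m bc by auto
    then have "card (insert m {m' \<in> M. adj m' a}) \<le> f c"
      using assms(1) unfolding f_def by (intro card_mono) auto
    then have "f a < f c" using m assms(1) by (simp add: f_def)
    with a(2)[OF bc(2)] show False by simp
  qed
qed

end

section \<open>Hitting large cliques and small demands\<close>

text \<open>
  \<open>(2 * N - 2) div 7\<close> is wrong only at \<open>N = 4\<close>, where a single 4-clique needs one vertex, and at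
  \<open>N \<le> 0\<close>. The jump at 4 is what breaks \<open>beta_minus_7\<close> at \<open>N = 11\<close>.
\<close>

definition beta :: "int \<Rightarrow> int" where
  "beta N = (if N \<le> 0 then 0 else if N = 4 then 1 else (2 * N - 2) div 7)"

lemma beta_mono: "M \<le> N \<Longrightarrow> beta M \<le> beta N"
  unfolding beta_def by (auto intro: zdiv_mono1)

text \<open>Raising \<open>N\<close> by 3 adds 6/7 before rounding, and the jump at 4 still fits
  because \<open>beta 1 = 0\<close>.\<close>

lemma beta_add_3: "beta (N + 3) \<le> beta N + 1"
proof -
  have "(2 * N - 2) div 7 + 1 = (2 * N - 2 + 7) div 7" by simp
  moreover have "(2 * N + 4) div 7 \<le> (2 * N - 2 + 7) div 7" by (rule zdiv_mono1) simp_all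
  moreover have "(2 * N + 4) div 7 \<le> 4 div 7" if "N \<le> 0" using that by (intro zdiv_mono1) simp_all
  ultimately show ?thesis unfolding beta_def by auto
qed

text \<open>A drop of 4 pays for one chosen vertex, since 8/7 exceeds 1. The case
  \<open>N = 4\<close> rests on the exceptional value \<open>beta 4 = 1\<close>.\<close>

lemma beta_minus_4:
  assumes "4 \<le> N"
  shows "beta (N - 4) + 1 \<le> beta N"
proof -
  have "(2 * N - 10) div 7 + 1 = (2 * N - 10 + 7) div 7" by simp
  also have "\<dots> \<le> (2 * N - 2) div 7" by (rule zdiv_mono1) simp_all
  finally show ?thesis using assms unfolding beta_def by (simp split: if_splits)
qed

text \<open>A drop of 7 pays for exactly two vertices. It fails at \<open>N = 7\<close> because
  \<open>beta 0\<close> is 0 where the formula would give -1.\<close>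

lemma beta_minus_7: "8 \<le> N \<Longrightarrow> N \<noteq> 11 \<Longrightarrow> beta (N - 7) + 2 \<le> beta N"
  unfolding beta_def by (simp split: if_splits)

abbreviation triples :: "'a set set \<Rightarrow> 'a set set" where
  "triples F \<equiv> {D \<in> F. card D = 3}"

abbreviation pairs :: "'a set set \<Rightarrow> 'a set set" where
  "pairs F \<equiv> {D \<in> F. card D = 2}"

text \<open>
  A triple costs one vertex, since it replaces a simplicial vertex of a clique, and a pair costs
  \<open>3/2\<close>: it contributes a whole element of the transversal, worth \<open>7/2\<close> vertices, to \<open>bound\<close> and
  \<open>-2\<close> to \<open>net_size\<close>.
\<close>

definition net_size :: "'a set \<Rightarrow> 'a set set \<Rightarrow> int" where
  "net_size U F = int (card U) + int (card (triples F)) - 2 * int (card (pairs F))"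

definition bound :: "'a set \<Rightarrow> 'a set set \<Rightarrow> int" where
  "bound U F = int (card (pairs F)) + beta (net_size U F)"

text \<open>Upper estimates of the counts suffice although pairs enter \<open>net_size\<close>
  negatively: one more pair adds 1 and lowers \<open>beta\<close> by at most 1.\<close>

lemma bound_le:
  assumes "int (card U) \<le> n" "int (card (triples F)) \<le> t" "int (card (pairs F)) \<le> p"
  shows "bound U F \<le> p + beta (n + t - 2 * p)"
proof -
  have 1: "k + beta (m - 2 * k) \<le> k + int d + beta (m - 2 * (k + int d))" for m k d
  proof (induction d)
    case (Suc d)
    let ?x = "m - 2 * (k + int (Suc d))"
    have "beta (?x + 2) \<le> beta (?x + 3)" by (rule beta_mono) simp
    also have "\<dots> \<le> beta ?x + 1" by (rule beta_add_3)
    finally have "beta (?x + 2) \<le> beta ?x + 1" .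
    moreover have "?x + 2 = m - 2 * (k + int d)" by simp
    ultimately have "beta (m - 2 * (k + int d)) \<le> beta ?x + 1" by metis
    with Suc show ?case unfolding of_nat_Suc by linarith
  qed simp
  let ?k = "int (card (pairs F))"
  obtain d where d: "p = ?k + int d" using assms(3) zle_iff_zadd by blast
  have "bound U F \<le> ?k + beta ((n + t) - 2 * ?k)"
    unfolding bound_def net_size_def using assms by (intro add_left_mono beta_mono) simp
  also have "\<dots> \<le> ?k + int d + beta ((n + t) - 2 * (?k + int d))" by (rule 1)
  finally show ?thesis using d by simp
qed

context simple_graph
begin

definition big_clique :: "'a set \<Rightarrow> 'a set \<Rightarrow> bool" where
  "big_clique U M \<longleftrightarrow> M \<subseteq> U \<and> clq M \<and> 4 \<le> card M \<and> (\<forall>x\<in>U - M. \<exists>y\<in>M. \<not> adj x y)"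

definition demands :: "'a set \<Rightarrow> 'a set set \<Rightarrow> bool" where
  "demands U F \<longleftrightarrow> finite U \<and> (\<forall>D\<in>F. D \<subseteq> U \<and> clq D \<and> (card D = 2 \<or> card D = 3))"

definition solution :: "'a set \<Rightarrow> 'a set set \<Rightarrow> 'a set \<Rightarrow> bool" where
  "solution U F T \<longleftrightarrow> T \<subseteq> U \<and> (\<forall>D\<in>F. D \<inter> T \<noteq> {}) \<and> (\<forall>M. big_clique U M \<longrightarrow> M \<inter> T \<noteq> {})"

lemma big_clique_maximal: "big_clique U M \<Longrightarrow> x \<in> U \<Longrightarrow> x \<notin> M \<Longrightarrow> \<exists>y\<in>M. \<not> adj x y"
  by (auto simp: big_clique_def)

lemma big_clique_Diff: "big_clique U M \<Longrightarrow> M \<inter> R = {} \<Longrightarrow> big_clique (U - R) M"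
  by (auto simp: big_clique_def)

text \<open>\<open>X\<close> joins the transversal, \<open>R\<close> is deleted and \<open>N\<close>
  is demanded instead. A clique containing a demand is hit with it, so of the cliques meeting
  \<open>R\<close> only those without a demand need attention.\<close>

lemma solution_reduce:
  assumes "X \<subseteq> R" "R \<subseteq> U"
    and dem: "\<And>D. D \<in> F \<Longrightarrow> D \<inter> R \<noteq> {} \<Longrightarrow> D \<inter> X \<noteq> {} \<or> (\<exists>D'\<in>N. D' \<subseteq> D)"
    and cliques: "\<And>M. big_clique U M \<Longrightarrow> M \<inter> R \<noteq> {} \<Longrightarrow> \<forall>D\<in>F. \<not> D \<subseteq> M \<Longrightarrow> M \<inter> X \<noteq> {} \<or> (\<exists>D'\<in>N. D' \<subseteq> M)"
    and solution: "solution (U - R) ({D \<in> F. D \<inter> R = {}} \<union> N) T"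
  shows "solution U F (T \<union> X)"
proof -
  have N: "K \<inter> (T \<union> X) \<noteq> {}" if K: "\<exists>D'\<in>N. D' \<subseteq> K" for K
  proof -
    obtain D' where "D' \<in> N" "D' \<subseteq> K" using K by blast
    moreover from this have "D' \<inter> T \<noteq> {}" using solution by (simp add: solution_def)
    ultimately show ?thesis by blast
  qed
  have D: "D \<inter> (T \<union> X) \<noteq> {}" if "D \<in> F" for D
  proof (cases "D \<inter> R = {}")
    case True
    then have "D \<inter> T \<noteq> {}" using solution that by (simp add: solution_def)
    then show ?thesis by blast
  next
    case False
    then show ?thesis using dem[OF that] N[of D] by blast
  qed
  have "M \<inter> (T \<union> X) \<noteq> {}" if M: "big_clique U M" for M
  proof -
    consider "M \<inter> R = {}" | D where "D \<in> F" "D \<subseteq> M" | "M \<inter> R \<noteq> {}" "\<forall>D\<in>F. \<not> D \<subseteq> M" by blast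
    then show ?thesis
    proof cases
      case 1
      then have "M \<inter> T \<noteq> {}" using solution big_clique_Diff[OF M] by (simp add: solution_def)
      then show ?thesis by blast
    next
      case (2 D)
      then show ?thesis using D[of D] by blast
    next
      case 3
      then show ?thesis using cliques[OF M] N[of M] by blast
    qed
  qed
  then show ?thesis using D solution assms(1,2) by (auto simp: solution_def)
qed

definition free :: "'a set \<Rightarrow> 'a set set \<Rightarrow> 'a \<Rightarrow> bool" where
  "free U F x \<longleftrightarrow> x \<in> U \<and> (\<forall>M. big_clique U M \<and> x \<in> M \<longrightarrow> (\<exists>D\<in>F. D \<subseteq> M))"

end


section \<open>A minimal counterexample\<close>

text \<open>Minimality concerns the number of vertices only, so reductions may replace the demands
  freely.\<close>

locale minimal_counterexample = hole_free_graph +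
  fixes U :: "'a set" and F :: "'a set set"
  assumes demands: "demands U F"
    and smaller: "\<And>U' F'. card U' < card U \<Longrightarrow> demands U' F' \<Longrightarrow> \<exists>T. solution U' F' T \<and> int (card T) \<le> bound U' F'"
    and counterexample: "\<And>T. solution U F T \<Longrightarrow> bound U F < int (card T)"
begin

abbreviation "n_triples \<equiv> int (card (triples F))"
abbreviation "n_pairs \<equiv> int (card (pairs F))"
abbreviation "net \<equiv> net_size U F"

lemma finU: "finite U" using demands by (simp add: demands_def)

lemma finF: "finite F"
  using demands by (intro finite_subset[of F "Pow U"]) (auto simp: demands_def)

lemma dem_sub: "D \<in> F \<Longrightarrow> D \<subseteq> U" and dem_clq: "D \<in> F \<Longrightarrow> clq D"
  and dem_card: "D \<in> F \<Longrightarrow> card D = 2 \<or> card D = 3"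
  using demands by (auto simp: demands_def)

lemma dem_fin: "D \<in> F \<Longrightarrow> finite D"
  using dem_sub finU finite_subset by blast

text \<open>The cost account of a reduction. \<open>A\<close> and \<open>B\<close> may be any
  triples and pairs known to disappear; further losses only help, by
  \<open>bound_le\<close>.\<close>

lemma no_reduction:
  assumes "X \<subseteq> R" "R \<subseteq> U" "R \<noteq> {}"
    and "A \<subseteq> triples F" "\<And>D. D \<in> A \<Longrightarrow> D \<inter> R \<noteq> {}"
    and "B \<subseteq> pairs F" "\<And>D. D \<in> B \<Longrightarrow> D \<inter> R \<noteq> {}"
    and N: "finite N" "\<And>D. D \<in> N \<Longrightarrow> D \<subseteq> U - R \<and> clq D \<and> (card D = 2 \<or> card D = 3)"
    and dem: "\<And>D. D \<in> F \<Longrightarrow> D \<inter> R \<noteq> {} \<Longrightarrow> D \<inter> X \<noteq> {} \<or> (\<exists>D'\<in>N. D' \<subseteq> D)"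
    and cliques: "\<And>M. big_clique U M \<Longrightarrow> M \<inter> R \<noteq> {} \<Longrightarrow> \<forall>D\<in>F. \<not> D \<subseteq> M \<Longrightarrow> M \<inter> X \<noteq> {} \<or> (\<exists>D'\<in>N. D' \<subseteq> M)"
  shows "beta net < int (card X) + (card (pairs N) - int (card B)) + beta (net - card R - card A + card (triples N)
     + 2 * int (card B) - 2 * int (card (pairs N)))"
proof -
  let ?F = "{D \<in> F. D \<inter> R = {}} \<union> N"
  have finR: "finite R" using assms(2) finU finite_subset by blast
  have demands': "demands (U - R) ?F"
    using demands N by (auto simp: demands_def)
  have "card R \<le> card U" using assms(2) finU by (rule card_mono[rotated])
  then have cU: "int (card (U - R)) = int (card U) - int (card R)"
    using assms(2) finR by (simp add: card_Diff_subset of_nat_diff)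
  have "R \<noteq> {}" by fact
  with finR have "0 < card R" by (simp add: card_gt_0_iff)
  then have lt: "card (U - R) < card U" using cU by linarith
  obtain T where T: "solution (U - R) ?F T" "int (card T) \<le> bound (U - R) ?F"
    using smaller[OF lt demands'] by blast
  have "solution U F (T \<union> X)"
    using solution_reduce[OF assms(1,2) dem cliques T(1)] by blast
  then have *: "bound U F < int (card (T \<union> X))" by (rule counterexample)
  have "card (T \<union> X) \<le> card T + card X" by (rule card_Un_le)
  with * T(2) have **: "bound U F < bound (U - R) ?F + int (card X)" by linarith
  \<comment> \<open>Only an inequality: \<open>N\<close> may repeat surviving demands, and demands
    outside \<open>S\<close> may also meet \<open>R\<close>.\<close>
  have cnt: "int (card {D \<in> ?F. card D = k}) \<le> int (card {D \<in> F. card D = k}) - int (card S) + int (card {D \<in> N. card D = k})"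
    if "S \<subseteq> {D \<in> F. card D = k}" "\<And>D. D \<in> S \<Longrightarrow> D \<inter> R \<noteq> {}" for k S
  proof -
    have finS: "finite S" using that finF by (auto intro: finite_subset)
    have "{D \<in> ?F. card D = k} \<subseteq> ({D \<in> F. card D = k} - S) \<union> {D \<in> N. card D = k}"
      using that(2) by auto
    then have "card {D \<in> ?F. card D = k} \<le> card ({D \<in> F. card D = k} - S) + card {D \<in> N. card D = k}"
      using finF N(1) by (intro order_trans[OF card_mono card_Un_le]) auto
    moreover have "card ({D \<in> F. card D = k} - S) = card {D \<in> F. card D = k} - card S"
      using that finS by (simp add: card_Diff_subset)
    moreover have "card S \<le> card {D \<in> F. card D = k}"
      using that finF by (intro card_mono) auto
    ultimately show ?thesis by linarith
  qed
  have "bound (U - R) ?F \<le> (n_pairs - card B + card (pairs N)) +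
    beta (int (card (U - R)) + (n_triples - card A + card (triples N)) - 2 * (n_pairs - card B + card (pairs N)))"
    by (intro bound_le cnt assms) simp
  with ** show ?thesis unfolding cU bound_def net_size_def by (simp add: algebra_simps)
qed

lemma no_reduction_0:
  assumes "X \<subseteq> R" "R \<subseteq> U" "R \<noteq> {}"
    and "A \<subseteq> triples F" "\<And>D. D \<in> A \<Longrightarrow> D \<inter> R \<noteq> {}"
    and "B \<subseteq> pairs F" "\<And>D. D \<in> B \<Longrightarrow> D \<inter> R \<noteq> {}"
    and dem: "\<And>D. D \<in> F \<Longrightarrow> D \<inter> R \<noteq> {} \<Longrightarrow> D \<inter> X \<noteq> {}"
    and cliques: "\<And>M. big_clique U M \<Longrightarrow> M \<inter> R \<noteq> {} \<Longrightarrow> \<forall>D\<in>F. \<not> D \<subseteq> M \<Longrightarrow> M \<inter> X \<noteq> {}"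
  shows "beta net < int (card X) - int (card B) + beta (net - card R - card A + 2 * int (card B))"
proof -
  have "beta net < int (card X) + (card (pairs ({} :: 'a set set)) - int (card B)) +
      beta (net - card R - card A + card (triples ({} :: 'a set set)) + 2 * int (card B) - 2 * int (card (pairs ({} :: 'a set set))))"
    by (rule no_reduction) (use assms in \<open>simp_all\<close>)
  then show ?thesis by simp
qed

lemma no_reduction_2:
  assumes "X \<subseteq> R" "R \<subseteq> U" "R \<noteq> {}"
    and "A \<subseteq> triples F" "\<And>D. D \<in> A \<Longrightarrow> D \<inter> R \<noteq> {}"
    and "S \<subseteq> U - R" "clq S" "card S = 2"
    and dem: "\<And>D. D \<in> F \<Longrightarrow> D \<inter> R \<noteq> {} \<Longrightarrow> D \<inter> X \<noteq> {} \<or> S \<subseteq> D"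
    and cliques: "\<And>M. big_clique U M \<Longrightarrow> M \<inter> R \<noteq> {} \<Longrightarrow> \<forall>D\<in>F. \<not> D \<subseteq> M \<Longrightarrow> M \<inter> X \<noteq> {} \<or> S \<subseteq> M"
  shows "beta net < int (card X) + 1 + beta (net - card R - card A - 2)"
proof -
  have S: "pairs {S} = {S}" "triples {S} = {}" using assms(8) by auto
  have "beta net < int (card X) + (card (pairs {S}) - int (card ({} :: 'a set set))) +
      beta (net - card R - card A + card (triples {S}) + 2 * int (card ({} :: 'a set set)) - 2 * int (card (pairs {S})))"
    by (rule no_reduction) (use assms in \<open>simp_all\<close>)
  then show ?thesis unfolding S by simp
qed

lemma no_reduction_3:
  assumes "R \<subseteq> U" "R \<noteq> {}" "S \<subseteq> U - R" "clq S" "card S = 3"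
    and dem: "\<And>D. D \<in> F \<Longrightarrow> D \<inter> R = {}"
    and cliques: "\<And>M. big_clique U M \<Longrightarrow> M \<inter> R \<noteq> {} \<Longrightarrow> \<forall>D\<in>F. \<not> D \<subseteq> M \<Longrightarrow> S \<subseteq> M"
  shows "beta net < beta (net - card R + 1)"
proof -
  have S: "pairs {S} = {}" "triples {S} = {S}" using assms(5) by auto
  have "beta net < int (card ({} :: 'a set)) + (card (pairs {S}) - int (card ({} :: 'a set set))) +
      beta (net - card R - card ({} :: 'a set set) + card (triples {S}) + 2 * int (card ({} :: 'a set set)) - 2 * int (card (pairs {S})))"
    by (rule no_reduction) (use assms in \<open>simp_all\<close>)
  then show ?thesis unfolding S by simp
qed

text \<open>Choosing a shared vertex would serve two pairs at once; \<open>net\<close> then grows by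
  3, which costs at most the one vertex saved.\<close>

lemma pairs_eqI:
  assumes "D \<in> pairs F" "E \<in> pairs F" "x \<in> D" "x \<in> E"
  shows "D = E"
proof (rule ccontr)
  assume "D \<noteq> E"
  have "beta net < int (card {x}) - int (card {D, E}) + beta (net - card {x} - card ({} :: 'a set set) + 2 * int (card {D, E}))"
    by (rule no_reduction_0) (use assms dem_sub in auto)
  then show False using beta_add_3[of net] \<open>D \<noteq> E\<close> by (simp add: add.commute)
qed

text \<open>Choosing a shared vertex would trade a pair for a vertex and leave \<open>net\<close>
  unchanged: the lost vertex and triple offset the lost pair.\<close>

lemma pair_triple_disjoint:
  assumes "D \<in> pairs F" "E \<in> triples F"
  shows "D \<inter> E = {}"
proof (rule ccontr)
  assume "D \<inter> E \<noteq> {}"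
  then obtain x where x: "x \<in> D" "x \<in> E" by blast
  have "beta net < int (card {x}) - int (card {D}) + beta (net - card {x} - card {E} + 2 * int (card {D}))"
    by (rule no_reduction_0) (use assms x dem_sub in auto)
  then show False by simp
qed

text \<open>The pairs occupy twice their number of vertices outside the triples, which cancels their
  negative term in \<open>net_size\<close>.\<close>

lemma size_ge:
  assumes "Z \<subseteq> \<Union>(triples F)"
  shows "int (card Z) + n_triples \<le> net"
proof -
  have "card (\<Union>(pairs F)) = sum card (pairs F)"
    using pairs_eqI dem_fin by (intro card_Union_disjoint) (auto simp: pairwise_def disjnt_def)
  then have 1: "card (\<Union>(pairs F)) = 2 * card (pairs F)" by simp
  have 2: "finite (\<Union>(pairs F))" using finF dem_fin by auto
  have 3: "Z \<subseteq> U" using assms dem_sub by blast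
  have "Z \<inter> \<Union>(pairs F) = {}" using assms pair_triple_disjoint by blast
  then have "card (Z \<union> \<Union>(pairs F)) = card Z + 2 * card (pairs F)"
    using 1 2 3 finU by (subst card_Un_disjoint) (auto intro: finite_subset)
  moreover have "card (Z \<union> \<Union>(pairs F)) \<le> card U"
    using 3 dem_sub finU by (intro card_mono) auto
  ultimately show ?thesis unfolding net_size_def by linarith
qed

lemma triples_ge: "S \<subseteq> triples F \<Longrightarrow> int (card S) \<le> n_triples"
  using finF by (simp add: card_mono)

lemma at_most_two_triples:
  assumes "D \<in> triples F" "E \<in> triples F" "G \<in> triples F" "x \<in> D" "x \<in> E" "x \<in> G" "D \<noteq> E"
  shows "G = D \<or> G = E"
proof (rule ccontr)
  assume n: "\<not> ?thesis"
  have "card {D, E, G} = 3" using assms(7) n by (auto simp: card_insert_if)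
  moreover have "int (card D) + n_triples \<le> net" using assms by (intro size_ge) auto
  moreover have "card D = 3" "{D, E, G} \<subseteq> triples F" using assms by auto
  ultimately have net: "4 \<le> net" using triples_ge[of "{D, E, G}"] by linarith
  have "beta net < int (card {x}) - int (card ({} :: 'a set set)) +
      beta (net - card {x} - card {D, E, G} + 2 * int (card ({} :: 'a set set)))"
    by (rule no_reduction_0) (use assms dem_sub in auto)
  then show False using beta_minus_4[OF net] \<open>card {D, E, G} = 3\<close> by simp
qed

lemma demands_at:
  assumes "P \<in> triples F" "Q \<in> triples F" "P \<noteq> Q" "x \<in> P" "x \<in> Q" "D \<in> F" "x \<in> D"
  shows "D = P \<or> D = Q"
  using dem_card[OF assms(6)] pair_triple_disjoint[of D P] at_most_two_triples[of P Q D x] assms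
  by blast

section \<open>Free vertices and the triples through them\<close>

lemma free_unsat: "free U F x \<Longrightarrow> big_clique U M \<Longrightarrow> \<forall>D\<in>F. \<not> D \<subseteq> M \<Longrightarrow> x \<notin> M"
  by (auto simp: free_def)

lemma free_in_U: "free U F x \<Longrightarrow> x \<in> U"
  by (simp add: free_def)

text \<open>Otherwise the other vertex \<open>y\<close> of the pair can be chosen and
  \<open>x\<close> deleted, as it lies in no other demand; the bound stays the same.\<close>

lemma free_not_in_pair:
  assumes "free U F x" "D \<in> pairs F"
  shows "x \<notin> D"
proof
  assume x: "x \<in> D"
  obtain y where y: "D = {x, y}" "x \<noteq> y" using assms x by (auto simp: card_2_iff)
  have "beta net < int (card {y}) - int (card {D}) + beta (net - card {x, y} - card ({} :: 'a set set) + 2 * int (card {D}))"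
  proof (rule no_reduction_0)
    show "E \<inter> {y} \<noteq> {}" if "E \<in> F" "E \<inter> {x, y} \<noteq> {}" for E
    proof (cases "x \<in> E")
      case True
      then have "E = D"
        using dem_card[OF that(1)] that(1) pairs_eqI[of E D x] pair_triple_disjoint[of D E] assms x by blast
      then show ?thesis using y by simp
    qed (use that in auto)
  qed (use assms dem_sub y free_unsat in auto)
  then show False using y by simp
qed

text \<open>A free vertex in no demand can be deleted. If it lies in a single triple, it can be
  deleted by shrinking the triple to a pair: vertex, triple and new pair lower \<open>net\<close> by
  1 + 1 + 2, which pays for the pair.\<close>

lemma free_triples:
  assumes "free U F x"
  obtains P Q where "P \<in> triples F" "Q \<in> triples F" "P \<noteq> Q" "x \<in> P" "x \<in> Q"
proof -
  have "\<exists>D\<in>F. x \<in> D"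
  proof (rule ccontr)
    assume n: "\<not> ?thesis"
    have "beta net < int (card ({} :: 'a set)) - int (card ({} :: 'a set set)) +
        beta (net - card {x} - card ({} :: 'a set set) + 2 * int (card ({} :: 'a set set)))"
      by (rule no_reduction_0) (use n assms free_in_U free_unsat in auto)
    then show False using beta_mono[of "net - 1" net] by simp
  qed
  then obtain P where P: "P \<in> F" "x \<in> P" by blast
  then have P3: "P \<in> triples F" using dem_card free_not_in_pair[OF assms] by blast
  have "\<exists>Q\<in>F. x \<in> Q \<and> Q \<noteq> P"
  proof (rule ccontr)
    assume n: "\<not> ?thesis"
    have "int (card P) + n_triples \<le> net" using P3 by (intro size_ge) auto
    with triples_ge[of "{P}"] P3 have net: "4 \<le> net" by auto
    have "beta net < int (card ({} :: 'a set)) + 1 + beta (net - card {x} - card {P} - 2)"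
    proof (rule no_reduction_2)
      show "P - {x} \<subseteq> U - {x}" using dem_sub[OF P(1)] by auto
      show "clq (P - {x})" using dem_clq[OF P(1)] by (auto intro: clq_subset)
      show "card (P - {x}) = 2" using P3 P(2) dem_fin[OF P(1)] by simp
      show "D \<inter> {} \<noteq> {} \<or> P - {x} \<subseteq> D" if "D \<in> F" "D \<inter> {x} \<noteq> {}" for D
        using n that by auto
    qed (use P3 P assms free_in_U free_unsat in auto)
    then show False using beta_minus_4[OF net] by simp
  qed
  then obtain Q where "Q \<in> F" "x \<in> Q" "Q \<noteq> P" by blast
  moreover from this have "Q \<in> triples F" using dem_card free_not_in_pair[OF assms] by blast
  ultimately show thesis using that[of P Q] P3 P by blast
qed

lemma free_other_triple:
  assumes "free U F x" "P \<in> triples F" "x \<in> P"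
  obtains Q where "Q \<in> triples F" "P \<noteq> Q" "x \<in> Q"
  using free_triples[OF assms(1)] assms(2,3) by metis

text \<open>Choosing a second common vertex \<open>a\<close> would serve \<open>P\<close> and
  \<open>Q\<close>, the only demands at \<open>x\<close>, so \<open>x\<close> could go too: two
  vertices and two triples make a drop of 4.\<close>

lemma free_linear:
  assumes "free U F x" "P \<in> triples F" "Q \<in> triples F" "P \<noteq> Q" "x \<in> P" "x \<in> Q"
  shows "P \<inter> Q = {x}"
proof (rule ccontr)
  assume "P \<inter> Q \<noteq> {x}"
  then obtain a where a: "a \<in> P" "a \<in> Q" "a \<noteq> x" using assms by blast
  have "int (card P) + n_triples \<le> net" using assms by (intro size_ge) auto
  with triples_ge[of "{P}"] assms have net: "4 \<le> net" by auto
  have "beta net < int (card {a}) - int (card ({} :: 'a set set)) +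
      beta (net - card {a, x} - card {P, Q} + 2 * int (card ({} :: 'a set set)))"
  proof (rule no_reduction_0)
    show "D \<inter> {a} \<noteq> {}" if "D \<in> F" "D \<inter> {a, x} \<noteq> {}" for D
      using that demands_at[of P Q x D] assms a by auto
  qed (use assms a dem_sub free_unsat free_in_U in auto)
  then show False using beta_minus_4[OF net] assms(4) a(3) by simp
qed

lemma card_free_Un:
  assumes "free U F x" "P \<in> triples F" "Q \<in> triples F" "P \<noteq> Q" "x \<in> P" "x \<in> Q"
  shows "card (P \<union> Q) = 5"
proof -
  have "finite P" "finite Q" "card P = 3" "card Q = 3" using assms dem_fin by auto
  with card_Un_Int[of P Q] free_linear[OF assms] show ?thesis by simp
qed

text \<open>Otherwise choose \<open>a\<close>, which hits \<open>P\<close> and \<open>A\<close>,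
  delete \<open>x\<close> and shrink the other triple \<open>Q\<close> at \<open>x\<close> to a
  pair. Two vertices, three triples and the new pair lower \<open>net\<close> by 7 at a cost of
  2.\<close>

lemma free_link:
  assumes "net \<noteq> 11" "free U F x" "P \<in> triples F" "x \<in> P" "a \<in> P" "a \<noteq> x"
    and "A \<in> triples F" "a \<in> A"
  shows "A = P"
proof (rule ccontr)
  assume AP: "A \<noteq> P"
  obtain Q where Q: "Q \<in> triples F" "P \<noteq> Q" "x \<in> Q" using free_other_triple assms by blast
  have PQ: "P \<inter> Q = {x}" using free_linear[of x P Q] assms Q by blast
  then have aQ: "a \<notin> Q" using assms by blast
  then have AQ: "A \<noteq> Q" using assms by blast
  have "card (P \<union> Q) = 5" using card_free_Un[of x P Q] assms Q by blast
  moreover have "int (card (P \<union> Q)) + n_triples \<le> net" using assms Q by (intro size_ge) auto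
  ultimately have net: "8 \<le> net" using triples_ge[of "{P, A, Q}"] assms Q AP AQ by auto
  have fQ: "Q \<in> F" using Q by simp
  have "beta net < int (card {a}) + 1 + beta (net - card {a, x} - card {P, A, Q} - 2)"
  proof (rule no_reduction_2)
    show "Q - {x} \<subseteq> U - {a, x}" using dem_sub[OF fQ] aQ by auto
    show "clq (Q - {x})" using dem_clq[OF fQ] by (auto intro: clq_subset)
    show "card (Q - {x}) = 2" using Q dem_fin[OF fQ] by simp
    show "D \<inter> {a} \<noteq> {} \<or> Q - {x} \<subseteq> D" if "D \<in> F" "D \<inter> {a, x} \<noteq> {}" for D
      using that demands_at[of P Q x D] assms Q by auto
  qed (use assms Q dem_sub free_unsat free_in_U in auto)
  then show False using beta_minus_7[OF net assms(1)] AP AQ Q(2) assms(6) by simp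
qed

section \<open>Non-free vertices and the cliques without demands\<close>

definition nonfree :: "'a set" where
  "nonfree = {x \<in> U. \<not> free U F x}"

definition star :: "'a \<Rightarrow> 'a set" where
  "star v = insert v {w \<in> nonfree. adj v w}"

abbreviation unsat :: "'a set \<Rightarrow> bool" where
  "unsat M \<equiv> big_clique U M \<and> (\<forall>D\<in>F. \<not> D \<subseteq> M)"

lemma unsat_sub_nonfree: "unsat M \<Longrightarrow> M \<subseteq> nonfree"
  using free_unsat by (auto simp: nonfree_def big_clique_def)

text \<open>\<open>M\<close> has only non-free vertices, so it lies in \<open>star v\<close>, which
  is a clique by simpliciality; maximality of \<open>M\<close> gives equality.\<close>

lemma unsat_eq_star:
  assumes "simplicial nonfree v" "unsat M" "v \<in> M"
  shows "M = star v"
proof -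
  have M: "M \<subseteq> nonfree" using assms(2) by (rule unsat_sub_nonfree)
  have clM: "clq M" using assms(2) by (simp add: big_clique_def)
  have sub: "M \<subseteq> star v" using M clM assms(3) by (auto simp: star_def clq_def)
  have cl: "clq (star v)"
    unfolding star_def using assms(1) by (intro clq_insert) (auto simp: simplicial_def)
  have "star v \<subseteq> U" using assms(1) by (auto simp: star_def simplicial_def nonfree_def)
  have "k \<in> M" if "k \<in> star v" for k
  proof (rule ccontr)
    assume "k \<notin> M"
    then obtain y where "y \<in> M" "\<not> adj k y"
      using big_clique_maximal[of U M k] assms(2) \<open>k \<in> star v\<close> \<open>star v \<subseteq> U\<close> by blast
    moreover have "y \<in> star v" using sub \<open>y \<in> M\<close> by (rule subsetD)
    moreover have "k \<noteq> y" using \<open>k \<notin> M\<close> \<open>y \<in> M\<close> by metis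
    ultimately show False using cl \<open>k \<in> star v\<close> by (simp add: clq_def)
  qed
  with sub show ?thesis by blast
qed

lemma unsat_star:
  assumes "simplicial nonfree v"
  shows "unsat (star v)"
proof -
  have "v \<in> nonfree" using assms by (simp add: simplicial_def)
  then obtain M where "unsat M" "v \<in> M" by (auto simp: nonfree_def free_def)
  with unsat_eq_star[OF assms] show ?thesis by blast
qed

text \<open>A demand of non-free vertices would be part of \<open>star v\<close>, which contains no
  demand.\<close>

lemma demand_has_free:
  assumes "simplicial nonfree v" "D \<in> F" "v \<in> D"
  obtains a where "a \<in> D" "free U F a"
proof -
  have "\<not> D \<subseteq> star v" using unsat_star[OF assms(1)] assms(2) by blast
  then have "\<not> D \<subseteq> nonfree" using dem_clq[OF assms(2)] assms(3) by (auto simp: star_def clq_def)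
  then show thesis using that dem_sub[OF assms(2)] by (auto simp: nonfree_def)
qed

text \<open>If no demand contained \<open>v\<close>, it could be deleted and three other vertices of
  \<open>star v\<close> demanded, at equal \<open>net\<close>. A pair is impossible because the
  demand has a free vertex.\<close>

lemma simplicial_in_triple:
  assumes "simplicial nonfree v"
  obtains D where "D \<in> triples F" "v \<in> D"
proof -
  note C = unsat_star[OF assms]
  have vU: "v \<in> U" using assms by (auto simp: simplicial_def nonfree_def)
  have "\<exists>D\<in>F. v \<in> D"
  proof (rule ccontr)
    assume n: "\<not> ?thesis"
    have "finite (star v)" using C finU by (auto simp: big_clique_def intro: finite_subset)
    moreover have "v \<in> star v" by (simp add: star_def)
    moreover have "4 \<le> card (star v)" using C by (simp add: big_clique_def)
    ultimately have "3 \<le> card (star v - {v})" by simp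
    then obtain S where S: "S \<subseteq> star v - {v}" "card S = 3"
      by (meson obtain_subset_with_card_n)
    have "beta net < beta (net - card {v} + 1)"
    proof (rule no_reduction_3)
      show "S \<subseteq> U - {v}" using S C by (auto simp: big_clique_def)
      show "clq S" using S C by (auto simp: big_clique_def intro: clq_subset)
      show "S \<subseteq> M" if "big_clique U M" "M \<inter> {v} \<noteq> {}" "\<forall>D\<in>F. \<not> D \<subseteq> M" for M
        using unsat_eq_star[OF assms, of M] that S by blast
    qed (use vU n S in auto)
    then show False by simp
  qed
  then obtain D where D: "D \<in> F" "v \<in> D" by blast
  have "D \<in> triples F"
  proof (rule ccontr)
    assume "D \<notin> triples F"
    then have "D \<in> pairs F" using D dem_card by blast
    moreover obtain a where "a \<in> D" "free U F a" using demand_has_free[OF assms D] by blast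
    ultimately show False using free_not_in_pair by blast
  qed
  with D that show thesis by blast
qed

text \<open>Otherwise \<open>b\<close> hits \<open>D\<close>, \<open>B\<close> and the only
  unsatisfied clique at \<open>v\<close>; choosing it lets \<open>v\<close> be deleted, a drop of 4.
  This also works at size 11, where \<open>no_simplicial\<close> is silent.\<close>

lemma simplicial_in_one_triple:
  assumes "simplicial nonfree v" "D \<in> triples F" "v \<in> D" "\<And>E. E \<in> F \<Longrightarrow> v \<in> E \<Longrightarrow> E = D"
    and "b \<in> D" "b \<in> nonfree" "b \<noteq> v" "B \<in> triples F" "b \<in> B"
  shows "B = D"
proof (rule ccontr)
  assume BD: "B \<noteq> D"
  have fD: "D \<in> F" using assms by simp
  have "int (card D) + n_triples \<le> net" using assms by (intro size_ge) auto
  with triples_ge[of "{D}"] assms have net: "4 \<le> net" by auto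
  have "adj v b" using dem_clq[OF fD] assms by (auto simp: clq_def)
  then have b: "b \<in> star v" using assms by (auto simp: star_def)
  have "beta net < int (card {b}) - int (card ({} :: 'a set set)) +
      beta (net - card {b, v} - card {D, B} + 2 * int (card ({} :: 'a set set)))"
  proof (rule no_reduction_0)
    show "E \<inter> {b} \<noteq> {}" if "E \<in> F" "E \<inter> {b, v} \<noteq> {}" for E
      using that assms(4)[of E] assms(5) by auto
    show "M \<inter> {b} \<noteq> {}" if "big_clique U M" "M \<inter> {b, v} \<noteq> {}" "\<forall>D\<in>F. \<not> D \<subseteq> M" for M
      using that unsat_eq_star[OF assms(1), of M] b by auto
    show "{b, v} \<subseteq> U" using dem_sub[OF fD] assms by auto
  qed (use assms in auto)
  then show False using beta_minus_4[OF net] BD assms(7) by simp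
qed

text \<open>
  If \<open>v\<close> lies in the triple \<open>{v, a, b}\<close> with \<open>a\<close> free, pick \<open>b\<close>: it hits the only unsatisfied clique
  through \<open>v\<close>, so \<open>v\<close> and \<open>a\<close> can be discarded once the other triple at \<open>a\<close> is shrunk to a pair.
\<close>

lemma no_simplicial:
  assumes "net \<noteq> 7" "net \<noteq> 11"
  shows "\<not> simplicial nonfree v"
proof
  assume v: "simplicial nonfree v"
  obtain D where D: "D \<in> triples F" "v \<in> D" using simplicial_in_triple[OF v] by blast
  then have fD: "D \<in> F" by simp
  obtain a where a: "a \<in> D" "free U F a" using demand_has_free[OF v fD D(2)] by blast
  have vn: "v \<in> nonfree" using v by (simp add: simplicial_def)
  then have av: "a \<noteq> v" using a by (auto simp: nonfree_def)
  obtain Q where Q: "Q \<in> triples F" "D \<noteq> Q" "a \<in> Q" using free_other_triple[OF a(2) D(1) a(1)] by blast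
  then have fQ: "Q \<in> F" by simp
  have DQ: "D \<inter> Q = {a}" using free_linear[OF a(2) D(1) Q(1,2) a(1) Q(3)] .
  obtain b where b: "D = {a, v, b}" "b \<noteq> a" "b \<noteq> v"
  proof -
    have "card (D - {a, v}) = 1" using D a av dem_fin[OF fD] by (simp add: card_Diff_subset)
    then obtain b where "D - {a, v} = {b}" by (auto simp: card_1_singleton_iff)
    then have "D = {a, v, b}" "b \<noteq> a" "b \<noteq> v" using D a by auto
    then show thesis by (rule that)
  qed
  have only: "E = D" if "E \<in> F" "c \<in> E" "c \<in> D" "c \<noteq> a" for E c
    using that dem_card[OF that(1)] pair_triple_disjoint[of E D] D(1) free_link[OF assms(2) a(2) D(1) a(1), of c E]
    by blast
  have bU: "b \<in> U" using dem_sub[OF fD] b by auto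
  have "\<not> free U F b"
  proof
    assume "free U F b"
    then obtain P Q where "P \<in> triples F" "Q \<in> triples F" "P \<noteq> Q" "b \<in> P" "b \<in> Q"
      by (rule free_triples)
    then show False using only[of P b] only[of Q b] b by simp
  qed
  then have bW: "b \<in> nonfree" using bU by (simp add: nonfree_def)
  have "adj v b" using dem_clq[OF fD] b by (auto simp: clq_def)
  then have bC: "b \<in> star v" using bW by (simp add: star_def)
  have "card (D \<union> Q) = 5" using card_free_Un[OF a(2) D(1) Q(1,2) a(1) Q(3)] .
  moreover have "int (card (D \<union> Q)) + n_triples \<le> net" using D Q by (intro size_ge) auto
  moreover have "2 \<le> n_triples" using triples_ge[of "{D, Q}"] D Q by auto
  \<comment> \<open>Five vertices and two triples give only 7, so \<open>net \<noteq> 7\<close>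
    enters here.\<close>
  ultimately have net: "8 \<le> net" using assms by linarith
  have "beta net < int (card {b}) + 1 + beta (net - card {a, b, v} - card {D, Q} - 2)"
  proof (rule no_reduction_2)
    show "Q - {a} \<subseteq> U - {a, b, v}" using dem_sub[OF fQ] DQ b by auto
    show "clq (Q - {a})" using dem_clq[OF fQ] by (auto intro: clq_subset)
    show "card (Q - {a}) = 2" using Q dem_fin[OF fQ] by simp
    show "E \<inter> {b} \<noteq> {} \<or> Q - {a} \<subseteq> E" if "E \<in> F" "E \<inter> {a, b, v} \<noteq> {}" for E
    proof -
      have "E = D \<or> E = Q" using that only[of E] demands_at[OF D(1) Q(1,2) a(1) Q(3), of E] b by auto
      then show ?thesis using b by auto
    qed
    show "M \<inter> {b} \<noteq> {} \<or> Q - {a} \<subseteq> M" if "big_clique U M" "M \<inter> {a, b, v} \<noteq> {}" "\<forall>D\<in>F. \<not> D \<subseteq> M" for M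
      using that unsat_eq_star[OF v, of M] bC free_unsat[OF a(2), of M] by auto
  qed (use D Q b dem_sub[OF fD] in auto)
  then show False using beta_minus_7[OF net assms(2)] Q(2) b av by simp
qed

text \<open>Some vertex of \<open>M\<close> has no neighbour in \<open>A\<close>, or else
  \<open>common_neighbour\<close> yields a vertex of \<open>A\<close> extending \<open>M\<close>. So
  \<open>simplicial_far\<close> gives a simplicial \<open>z\<close> away from \<open>A\<close>;
  triples through \<open>z\<close> are cliques and miss \<open>A\<close>, and one of them has a free
  vertex.\<close>

lemma uncovered_triple:
  assumes "conn A" "A \<subseteq> U" "unsat M" "M \<inter> A = {}"
  obtains E e where "E \<in> triples F" "E \<inter> A = {}" "e \<in> E" "free U F e"
proof -
  have finM: "finite M" using assms(3) finU by (auto simp: big_clique_def intro: finite_subset)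
  have "\<exists>x\<in>M. \<forall>a\<in>A. \<not> adj x a"
  proof (rule ccontr)
    assume n: "\<not> ?thesis"
    have "clq M" using assms(3) by (simp add: big_clique_def)
    then obtain a where a: "a \<in> A" "\<forall>m\<in>M. adj m a"
      using common_neighbour[OF finM _ assms(1,4)] n by blast
    then have "a \<in> U - M" using assms by blast
    then obtain y where "y \<in> M" "\<not> adj a y" using big_clique_maximal[of U M a] assms(3) by blast
    then show False using a(2) sym[of y a] by simp
  qed
  then obtain x where x: "x \<in> M" "\<And>a. a \<in> A \<Longrightarrow> \<not> adj x a" by blast
  then have xU: "x \<in> U" "x \<notin> A" using assms by (auto simp: big_clique_def)
  have "\<exists>z. simplicial U z \<and> z \<notin> A \<and> (\<forall>a\<in>A. \<not> adj z a)"
    by (rule simplicial_far[OF finU assms(2,1) xU x(2)])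
  then obtain z where z: "simplicial U z" "z \<notin> A" "\<And>a. a \<in> A \<Longrightarrow> \<not> adj z a" by metis
  have miss: "E \<inter> A = {}" if "E \<in> triples F" "z \<in> E" for E
  proof (rule ccontr)
    assume "E \<inter> A \<noteq> {}"
    then obtain a where "a \<in> E" "a \<in> A" by blast
    moreover from this have "adj z a" using that z(2) dem_clq[of E] by (auto simp: clq_def)
    ultimately show False using z(3) by blast
  qed
  show thesis
  proof (cases "free U F z")
    case True
    then obtain P where "P \<in> triples F" "z \<in> P" by (rule free_triples)
    then show thesis using that[of P z] miss True by simp
  next
    case False
    then have "z \<in> nonfree" using z(1) by (simp add: nonfree_def simplicial_def)
    then have zW: "simplicial nonfree z" by (intro simplicial_subset[OF z(1)]) (auto simp: nonfree_def)
    then obtain E where "E \<in> triples F" "z \<in> E" by (rule simplicial_in_triple)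
    moreover from this obtain e where "e \<in> E" "free U F e" using demand_has_free[OF zW, of E] by blast
    ultimately show thesis using that[of E e] miss by simp
  qed
qed

lemma no_free_cover:
  assumes "conn A" "\<And>a. a \<in> A \<Longrightarrow> free U F a" "\<And>D. D \<in> triples F \<Longrightarrow> D \<inter> A \<noteq> {}"
  shows "nonfree = {}"
proof (rule ccontr)
  assume "nonfree \<noteq> {}"
  then obtain M where M: "unsat M" by (auto simp: nonfree_def free_def)
  then have "M \<inter> A = {}" using assms(2) free_unsat by blast
  moreover have "A \<subseteq> U" using assms(2) free_in_U by blast
  ultimately obtain E where "E \<in> triples F" "E \<inter> A = {}"
    using uncovered_triple[OF assms(1) _ M] by metis
  with assms(3) show False by blast
qed

lemma finite_triples: "finite (\<Union>(triples F))"
proof -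
  have "\<Union>(triples F) \<subseteq> U" using dem_sub by blast
  then show ?thesis using finU by (rule finite_subset)
qed

section \<open>The exceptional sizes 7 and 11\<close>

lemma sum_degrees: "(\<Sum>x\<in>\<Union>(triples F). card {D \<in> triples F. x \<in> D}) = 3 * card (triples F)"
proof -
  have "\<forall>D\<in>triples F. card {x \<in> \<Union>(triples F). x \<in> D} = 3"
  proof
    fix D assume "D \<in> triples F"
    then have "{x \<in> \<Union>(triples F). x \<in> D} = D" by blast
    then show "card {x \<in> \<Union>(triples F). x \<in> D} = 3" using \<open>D \<in> triples F\<close> by simp
  qed
  then have "(\<Sum>x\<in>\<Union>(triples F). card {D \<in> triples F. x \<in> D}) = (\<Sum>D\<in>triples F. 3)"
    using finF finite_triples by (intro sum_multicount_gen) auto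
  then show ?thesis by simp
qed

lemma degree_le: "card {D \<in> triples F. x \<in> D} \<le> 2"
proof (rule ccontr)
  assume "\<not> ?thesis"
  then have "3 \<le> card {D \<in> triples F. x \<in> D}" by simp
  then obtain S where S: "S \<subseteq> {D \<in> triples F. x \<in> D}" "card S = 3"
    by (rule obtain_subset_with_card_n)
  from S(2) obtain D E G where "S = {D, E, G}" "D \<noteq> E" "G \<noteq> D" "G \<noteq> E"
    by (auto simp: card_3_iff)
  with S(1) have "{D, E, G} \<subseteq> {D \<in> triples F. x \<in> D}" "D \<noteq> E" "G \<noteq> D" "G \<noteq> E" by simp_all
  then show False using at_most_two_triples[of D E G x] by auto
qed

text \<open>Double counting: each vertex is in at most two triples. With \<open>size_ge\<close> this
  leaves at most two triples at \<open>net = 7\<close> and four at \<open>net = 11\<close>.\<close>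

lemma triples_le: "5 * n_triples \<le> 2 * net"
proof -
  have "3 * card (triples F) \<le> 2 * card (\<Union>(triples F))"
    unfolding sum_degrees[symmetric]
    using sum_bounded_above[of "\<Union>(triples F)" "\<lambda>x. card {D \<in> triples F. x \<in> D}" "2 :: nat"] degree_le
    by (simp add: mult.commute)
  moreover have "int (card (\<Union>(triples F))) + n_triples \<le> net" by (rule size_ge) simp
  ultimately show ?thesis by linarith
qed

text \<open>If all vertices were free, there would be no pairs and each vertex would lie in exactly
  two triples. Then \<open>free_link\<close> leaves only size 11, which divisibility
  excludes.\<close>

lemma nonfree_nonempty: "nonfree \<noteq> {}"
proof
  assume "nonfree = {}"
  then have fr: "free U F x" if "x \<in> U" for x using that by (auto simp: nonfree_def)
  have no_pairs: "pairs F = {}"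
  proof (rule ccontr)
    assume "pairs F \<noteq> {}"
    then obtain D where D: "D \<in> pairs F" by blast
    then obtain x where "x \<in> D" by (auto simp: card_2_iff)
    then show False using D dem_sub fr free_not_in_pair by blast
  qed
  show False
  proof (cases "U = {}")
    case True
    then have "F = {}" using dem_sub dem_card by force
    then have "solution U F {}" using True by (auto simp: solution_def big_clique_def)
    from counterexample[OF this] show False using True \<open>F = {}\<close>
      by (simp add: bound_def net_size_def beta_def)
  next
    case False
    then obtain x where x: "x \<in> U" by blast
    obtain P where P: "P \<in> triples F" "x \<in> P" using free_triples[OF fr[OF x]] by metis
    have "card (P - {x}) = 2" using P dem_fin[of P] by simp
    then obtain a where a: "a \<in> P" "a \<noteq> x" by (auto simp: card_2_iff)
    then have "a \<in> U" using P dem_sub by blast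
    then obtain A where "A \<in> triples F" "P \<noteq> A" "a \<in> A" using free_other_triple[OF fr P(1) a(1)] by blast
    then have 11: "net = 11" using free_link[OF _ fr[OF x] P a] by blast
    have "card {D \<in> triples F. x \<in> D} = 2" if y: "x \<in> U" for x
    proof -
      obtain P Q where PQ: "P \<in> triples F" "Q \<in> triples F" "P \<noteq> Q" "x \<in> P" "x \<in> Q"
        using free_triples[OF fr[OF y]] .
      then have "card {P, Q} \<le> card {D \<in> triples F. x \<in> D}" using finF by (intro card_mono) auto
      with degree_le[of x] PQ(3) show ?thesis by simp
    qed
    moreover have "\<Union>(triples F) = U"
    proof
      show "\<Union>(triples F) \<subseteq> U" using dem_sub by blast
      show "U \<subseteq> \<Union>(triples F)"
      proof
        fix x assume "x \<in> U"
        then obtain P where "P \<in> triples F" "x \<in> P" using free_triples[OF fr] by metis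
        then show "x \<in> \<Union>(triples F)" by blast
      qed
    qed
    ultimately have "3 * card (triples F) = 2 * card U" using sum_degrees by simp
    \<comment> \<open>With \<open>n\<close> vertices and \<open>t\<close> triples,
      \<open>3 * t = 2 * n\<close> and \<open>n + t = 11\<close> give
      \<open>5 * n = 33\<close>.\<close>
    then show False using 11 unfolding net_size_def no_pairs by simp presburger
  qed
qed

text \<open>At size 11 the bound exceeds the number of pairs by two, so one vertex of each pair can
  be added to \<open>X\<close>.\<close>

lemma two_transversal:
  assumes "X \<subseteq> U" "card X = 2" "net = 11"
    and "\<And>D. D \<in> triples F \<Longrightarrow> D \<inter> X \<noteq> {}" "\<And>M. unsat M \<Longrightarrow> M \<inter> X \<noteq> {}"
  shows False
proof -
  define c where "c D = (SOME x. x \<in> D)" for D :: "'a set"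
  have c: "c D \<in> D" if "D \<in> pairs F" for D
  proof -
    have "D \<noteq> {}" using that by auto
    then show ?thesis unfolding c_def by (simp add: some_in_eq)
  qed
  let ?T = "X \<union> c ` pairs F"
  have D: "D \<inter> ?T \<noteq> {}" if D: "D \<in> F" for D
  proof (cases "card D = 3")
    case True
    then show ?thesis using assms(4)[of D] D by blast
  next
    case False
    then have "D \<in> pairs F" using D dem_card by blast
    then show ?thesis using c[of D] by blast
  qed
  have M: "M \<inter> ?T \<noteq> {}" if M: "big_clique U M" for M
  proof (cases "\<forall>D\<in>F. \<not> D \<subseteq> M")
    case True
    then have "M \<inter> X \<noteq> {}" using assms(5)[of M] M by simp
    then show ?thesis by blast
  next
    case False
    then obtain K where "K \<in> F" "K \<subseteq> M" by blast
    then show ?thesis using D[of K] by blast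
  qed
  have "?T \<subseteq> U"
  proof
    fix x assume "x \<in> ?T"
    then consider "x \<in> X" | K where "K \<in> pairs F" "x = c K" by blast
    then show "x \<in> U"
    proof cases
      case (2 K)
      then show ?thesis using c[of K] dem_sub[of K] by blast
    qed (use assms(1) in blast)
  qed
  with D M have "solution U F ?T" by (simp add: solution_def)
  then have "bound U F < int (card ?T)" by (rule counterexample)
  also have "card ?T \<le> card X + card (c ` pairs F)" by (rule card_Un_le)
  also have "card (c ` pairs F) \<le> card (pairs F)" using finF by (intro card_image_le) auto
  finally show False using assms(2,3) by (simp add: bound_def beta_def)
qed

text \<open>The path \<open>a\<close>, \<open>v\<close>, \<open>e\<close> meets every triple, so by
  \<open>uncovered_triple\<close> each unsatisfied clique contains \<open>v\<close> and is
  \<open>star v\<close>. Two vertices hitting the four triples and \<open>star v\<close> then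
  contradict \<open>two_transversal\<close>.\<close>

lemma two_bowties_aux:
  assumes "net = 11" "triples F = {D, Q, E, G}" "D \<noteq> Q" "E \<noteq> G"
    and a: "free U F a" "a \<in> D" "a \<in> Q" "a \<notin> E" "a \<notin> G"
    and e: "free U F e" "e \<in> E" "e \<in> G" "e \<notin> D" "e \<notin> Q"
    and S: "S = (D \<union> Q) \<inter> (E \<union> G)" "3 \<le> card S" "S \<subseteq> nonfree"
    and v: "simplicial nonfree v" "v \<in> D" "v \<in> E"
  shows False
proof -
  have T: "D \<in> triples F" "Q \<in> triples F" "E \<in> triples F" "G \<in> triples F" using assms(2) by auto
  have fF: "D \<in> F" "Q \<in> F" "E \<in> F" "G \<in> F" using T by auto
  have vn: "v \<in> nonfree" using v by (simp add: simplicial_def)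
  then have va: "v \<noteq> a" "v \<noteq> e" using a e by (auto simp: nonfree_def)
  have DQ: "D \<inter> Q = {a}" using free_linear[OF a(1) T(1,2) assms(3) a(2,3)] .
  have EG: "E \<inter> G = {e}" using free_linear[OF e(1) T(3,4) assms(4) e(2,3)] .
  have "adj a v" "adj v e"
    using dem_clq[OF fF(1)] dem_clq[OF fF(3)] a e v va by (auto simp: clq_def)
  then have conn: "conn {e, v, a}"
    using conn_insert[of "{a}" a v] conn_insert[of "{v, a}" v e] conn_singleton by simp
  have un: "M = star v" if M: "unsat M" for M
  proof -
    have "M \<inter> {e, v, a} \<noteq> {}"
    proof
      assume 0: "M \<inter> {e, v, a} = {}"
      have "{e, v, a} \<subseteq> U" using dem_sub[OF fF(1)] dem_sub[OF fF(3)] a e v by auto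
      then obtain K where "K \<in> triples F" "K \<inter> {e, v, a} = {}"
        using uncovered_triple[OF conn _ M 0] by metis
      then show False using assms(2) a e by auto
    qed
    moreover have "a \<notin> M" "e \<notin> M" using free_unsat a(1) e(1) M by blast+
    ultimately show ?thesis using unsat_eq_star[OF v(1) M] by blast
  qed
  have vU: "v \<in> U" using vn by (simp add: nonfree_def)
  show False
  proof (cases "Q \<inter> G = {}")
    case False
    then obtain y where y: "y \<in> Q" "y \<in> G" by blast
    have "y \<noteq> v" using y v DQ va by blast
    then have "card {v, y} = 2" by simp
    moreover have "{v, y} \<subseteq> U" using vU y dem_sub[OF fF(2)] by auto
    moreover have "v \<in> star v" by (simp add: star_def)
    moreover have "K \<inter> {v, y} \<noteq> {}" if "K \<in> triples F" for K
    proof -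
      have "K \<in> {D, Q, E, G}" using that unfolding assms(2) .
      then show ?thesis using v(2,3) y by auto
    qed
    moreover have "M \<inter> {v, y} \<noteq> {}" if "unsat M" for M
      unfolding un[OF that] using \<open>v \<in> star v\<close> by blast
    ultimately show False using two_transversal[of "{v, y}"] assms(1) by blast
  next
    case True
    have cD: "card (D - {a, v}) = 1" "card (E - {e, v}) = 1"
      using T fF a e v va dem_fin by (auto simp: card_Diff_subset)
    \<comment> \<open>Here \<open>D = {a, v, q}\<close> and \<open>E = {e, v, s}\<close>. As
      \<open>Q\<close> and \<open>G\<close> are disjoint, the three shared vertices must be
      \<open>v\<close>, \<open>q\<close>, \<open>s\<close>; so \<open>q\<close> lies in
      \<open>G\<close> and \<open>s\<close> in \<open>Q\<close>, and together they hit all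
      triples.\<close>
    obtain q s where q: "D - {a, v} = {q}" and s: "E - {e, v} = {s}"
      using cD by (auto simp: card_1_singleton_iff)
    have "S \<subseteq> {v, q, s}"
    proof
      fix x assume x: "x \<in> S"
      then have "x \<noteq> a" "x \<noteq> e" using S(3) a e by (auto simp: nonfree_def)
      moreover have "x \<in> D \<or> x \<in> E" using x S(1) True by blast
      ultimately show "x \<in> {v, q, s}" using q s by blast
    qed
    moreover have "card {v, q, s} \<le> 3" by (simp add: card_insert_if)
    moreover have "finite {v, q, s}" by simp
    ultimately have Seq: "S = {v, q, s}" using S(2) by (metis card_seteq order_trans)
    with S(2) have qs: "q \<noteq> s" by (auto simp: card_insert_if split: if_splits)
    have qD: "q \<in> D" "q \<noteq> v" and sE: "s \<in> E" "s \<noteq> v" using q s by auto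
    have qsS: "q \<in> S" "s \<in> S" using Seq by simp_all
    have "q \<notin> E"
    proof
      assume "q \<in> E"
      then have "q \<in> E - {e, v}" using qD e(4) by auto
      then show False using s qs by simp
    qed
    then have qG: "q \<in> G" using qsS(1) S(1) by simp
    have "s \<notin> D"
    proof
      assume "s \<in> D"
      then have "s \<in> D - {a, v}" using sE a(4) by auto
      then show False using q qs by simp
    qed
    then have sQ: "s \<in> Q" using qsS(2) S(1) by simp
    have "adj v q" using dem_clq[OF fF(1)] qD v(2) by (auto simp: clq_def)
    moreover have "q \<in> nonfree" using qsS(1) S(3) by (rule subsetD[rotated])
    ultimately have "q \<in> star v" by (simp add: star_def)
    moreover have "card {q, s} = 2" using qs by simp
    moreover have "{q, s} \<subseteq> U" using qD(1) sE(1) dem_sub[OF fF(1)] dem_sub[OF fF(3)] by blast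
    moreover have "K \<inter> {q, s} \<noteq> {}" if "K \<in> triples F" for K
    proof -
      have "K \<in> {D, Q, E, G}" using that unfolding assms(2) .
      then show ?thesis using qD(1) sE(1) qG sQ by auto
    qed
    moreover have "M \<inter> {q, s} \<noteq> {}" if "unsat M" for M
      unfolding un[OF that] using \<open>q \<in> star v\<close> by blast
    ultimately show False using two_transversal[of "{q, s}"] assms(1) by blast
  qed
qed

text \<open>If \<open>v\<close> is in \<open>E\<close> or \<open>G\<close>,
  \<open>two_bowties_aux\<close> applies up to symmetry. Otherwise \<open>D\<close> is the only
  demand at \<open>v\<close>. Since \<open>Q\<close> has just two vertices besides \<open>a\<close>,
  some shared vertex lies in \<open>D\<close>, against
  \<open>simplicial_in_one_triple\<close>.\<close>

lemma two_bowties: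
  assumes "net = 11" "triples F = {D, Q, E, G}" "D \<noteq> Q" "E \<noteq> G"
    and a: "free U F a" "a \<in> D" "a \<in> Q" "a \<notin> E" "a \<notin> G"
    and e: "free U F e" "e \<in> E" "e \<in> G" "e \<notin> D" "e \<notin> Q"
    and S: "S = (D \<union> Q) \<inter> (E \<union> G)" "3 \<le> card S" "S \<subseteq> nonfree"
    and v: "simplicial nonfree v" "v \<in> D"
  shows False
proof -
  have T: "D \<in> triples F" "Q \<in> triples F" "E \<in> triples F" "G \<in> triples F" using assms(2) by auto
  then have fF: "D \<in> F" "Q \<in> F" by auto
  have "v \<in> nonfree" using v by (simp add: simplicial_def)
  then have va: "v \<noteq> a" using a by (auto simp: nonfree_def)
  have DQ: "D \<inter> Q = {a}" using free_linear[OF a(1) T(1,2) assms(3) a(2,3)] .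
  consider "v \<in> E" | "v \<in> G" | "v \<notin> E" "v \<notin> G" by blast
  then show False
  proof cases
    case 1
    show False by (rule two_bowties_aux[OF assms(1-4) a e S v 1])
  next
    case 2
    have "triples F = {D, Q, G, E}" "S = (D \<union> Q) \<inter> (G \<union> E)" unfolding assms(2) S(1) by auto
    then show False
      by (rule two_bowties_aux[OF assms(1) _ assms(3) assms(4)[symmetric] a(1-3,5,4) e(1,3,2,4,5) _ S(2,3) v 2])
  next
    case 3
    have only: "K = D" if "K \<in> F" "v \<in> K" for K
    proof -
      have "K \<in> triples F"
        using that dem_card[of K] pair_triple_disjoint[of K D] T(1) v(2) by blast
      then have "K \<in> {D, Q, E, G}" unfolding assms(2) .
      moreover have "v \<notin> Q" using DQ v(2) va by blast
      ultimately show ?thesis using 3 that(2) by blast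
    qed
    have "\<not> S \<subseteq> Q - {a}"
    proof
      assume "S \<subseteq> Q - {a}"
      moreover have "card (Q - {a}) = 2" using T(2) a(3) dem_fin[OF fF(2)] by simp
      moreover have "finite (Q - {a})" using dem_fin[OF fF(2)] by simp
      ultimately show False using S(2) card_mono[of "Q - {a}" S] by simp
    qed
    moreover have "a \<notin> S" using S(1) a by blast
    ultimately obtain b where b: "b \<in> S" "b \<in> D" using S(1) by blast
    then obtain B where B: "B \<in> triples F" "b \<in> B" "B = E \<or> B = G" using S(1) T by blast
    have "b \<noteq> v" using B 3 by blast
    then have "B = D"
      using simplicial_in_one_triple[OF v(1) T(1) v(2) only b(2) _ _ B(1,2)] b(1) S(3) by blast
    then show False using B(3) a by blast
  qed
qed

text \<open>Sizes 7 and 11 remain. A third triple, missing \<open>a\<close>, excludes 7. At 11,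
  either connected free vertices meet all four triples, against \<open>nonfree_nonempty\<close>, or
  \<open>two_bowties\<close> applies.\<close>

lemma contradiction: False
proof -
  have "finite nonfree" using finU by (simp add: nonfree_def)
  then obtain v where v: "simplicial nonfree v" using simplicial_exists nonfree_nonempty by blast
  then have net: "net = 7 \<or> net = 11" using no_simplicial by blast
  obtain D where D: "D \<in> triples F" "v \<in> D" using simplicial_in_triple[OF v] .
  then have "D \<in> F" by simp
  then obtain a where a: "a \<in> D" "free U F a" using demand_has_free[OF v _ D(2)] by blast
  obtain Q where Q: "Q \<in> triples F" "D \<noteq> Q" "a \<in> Q" using free_other_triple[OF a(2) D(1) a(1)] .
  have small: "card (triples F) \<le> 4" and small7: "net = 7 \<Longrightarrow> card (triples F) \<le> 2"
    using triples_le net by auto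
  have all: "triples F = S" if "S \<subseteq> triples F" "card (triples F) \<le> card S" for S
    using card_seteq[of "triples F" S] that finF by auto
  obtain M where M: "unsat M" using unsat_star[OF v] by blast
  have miss: "M \<inter> A = {}" if "\<And>x. x \<in> A \<Longrightarrow> free U F x" for A
    using that free_unsat M by blast
  have "{a} \<subseteq> U" using a free_in_U by blast
  moreover have "M \<inter> {a} = {}" by (rule miss) (use a in auto)
  ultimately obtain E e where E: "E \<in> triples F" "E \<inter> {a} = {}" "e \<in> E" "free U F e"
    using uncovered_triple[OF conn_singleton _ M] by metis
  then have aE: "a \<notin> E" by simp
  then have DQE: "E \<noteq> D" "E \<noteq> Q" using a Q by auto
  have "card {D, Q, E} = 3" using Q(2) DQE by (simp add: card_insert_if eq_commute)
  moreover have "card {D, Q, E} \<le> card (triples F)" using D Q E finF by (intro card_mono) auto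
  ultimately have net: "net = 11" using small7 net by linarith
  obtain G where G: "G \<in> triples F" "E \<noteq> G" "e \<in> G" using free_other_triple[OF E(4,1,3)] .
  have ea: "e \<noteq> a" using E by blast
  show False
  proof (cases "G = D \<or> G = Q")
    case True
    then have "a \<in> G" using a Q by blast
    then have "adj a e" using G ea dem_clq[of G] by (auto simp: clq_def)
    then have conn: "conn {e, a}" using conn_insert[of "{a}" a e] conn_singleton by simp
    have "{e, a} \<subseteq> U" using a E free_in_U by blast
    moreover have "M \<inter> {e, a} = {}" by (rule miss) (use a E in auto)
    ultimately obtain H f where H: "H \<in> triples F" "H \<inter> {e, a} = {}" "f \<in> H" "free U F f"
      using uncovered_triple[OF conn _ M] by metis
    then have "H \<noteq> D" "H \<noteq> Q" "H \<noteq> E" using a Q E by auto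
    then have "card {D, Q, E, H} = 4" using Q(2) DQE by (simp add: card_insert_if eq_commute)
    then have all4: "triples F = {D, Q, E, H}" using all[of "{D, Q, E, H}"] D Q E H small by auto
    obtain K where K: "K \<in> triples F" "H \<noteq> K" "f \<in> K" using free_other_triple[OF H(4,1,3)] .
    \<comment> \<open>Only \<open>H\<close> misses \<open>{e, a}\<close>, so \<open>K\<close> links
      \<open>f\<close> to \<open>a\<close> or \<open>e\<close>.\<close>
    then have "a \<in> K \<or> e \<in> K" using all4 a Q E by auto
    then have "adj a f \<or> adj e f" using K H dem_clq[of K] by (auto simp: clq_def)
    then have "conn {f, e, a}"
      using conn_insert[OF conn, of a f] conn_insert[OF conn, of e f] by auto
    then have "nonfree = {}" by (rule no_free_cover) (use all4 a Q E H in auto)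
    then show False using nonfree_nonempty by blast
  next
    case False
    have "card {D, Q, E, G} = 4" using Q(2) DQE G(2) False by (simp add: card_insert_if eq_commute)
    then have all4: "triples F = {D, Q, E, G}" using all[of "{D, Q, E, G}"] D Q E G small by auto
    have aG: "a \<notin> G"
      using at_most_two_triples[OF D(1) Q(1) G(1) a(1) Q(3) _ Q(2)] False by blast
    have eD: "e \<notin> D" using at_most_two_triples[OF E(1) G(1) D(1) E(3) G(3) _ G(2)] DQE False by blast
    have eQ: "e \<notin> Q" using at_most_two_triples[OF E(1) G(1) Q(1) E(3) G(3) _ G(2)] DQE False by blast
    define S where "S = (D \<union> Q) \<inter> (E \<union> G)"
    have "card (D \<union> Q) = 5" using card_free_Un[OF a(2) D(1) Q(1,2) a(1) Q(3)] .
    moreover have "card (E \<union> G) = 5" using card_free_Un[OF E(4,1) G(1,2) E(3) G(3)] .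
    moreover have "finite (D \<union> Q)" "finite (E \<union> G)" using D Q E G dem_fin by auto
    moreover have "int (card (D \<union> Q \<union> (E \<union> G))) + n_triples \<le> net" using all4 by (intro size_ge) auto
    moreover have "card (triples F) = 4" using all4 \<open>card {D, Q, E, G} = 4\<close> by simp
    \<comment> \<open>At most 11 - 4 = 7 vertices lie in triples, while the two unions have five
      each.\<close>
    ultimately have S3: "3 \<le> card S"
      using card_Un_Int[of "D \<union> Q" "E \<union> G"] net unfolding S_def by linarith
    \<comment> \<open>A free shared vertex would connect \<open>a\<close> and \<open>e\<close> to a
      free set meeting all triples.\<close>
    have SW: "S \<subseteq> nonfree"
    proof
      fix f assume f: "f \<in> S"
      show "f \<in> nonfree"
      proof (rule ccontr)
        assume "f \<notin> nonfree"
        moreover have "f \<in> U" using f D Q dem_sub unfolding S_def by blast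
        ultimately have ff: "free U F f" by (simp add: nonfree_def)
        have "f \<noteq> a" "f \<noteq> e" using f aE aG eD eQ unfolding S_def by auto
        moreover obtain K where "K \<in> F" "a \<in> K" "f \<in> K" using f D Q a unfolding S_def by blast
        moreover obtain L where "L \<in> F" "e \<in> L" "f \<in> L" using f E G unfolding S_def by blast
        ultimately have "adj a f" "adj f e"
          using dem_clq[of K] dem_clq[of L] by (auto simp: clq_def)
        then have "conn {e, f, a}"
          using conn_insert[of "{a}" a f] conn_insert[of "{f, a}" f e] conn_singleton by simp
        then have "nonfree = {}" by (rule no_free_cover) (use all4 a Q E G ff in auto)
        then show False using nonfree_nonempty by blast
      qed
    qed
    show False
      using two_bowties[OF net all4 Q(2) G(2) a(2,1) Q(3) aE aG E(4,3) G(3) eD eQ S_def S3 SW v D(2)] .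
  qed
qed

end

theorem (in hole_free_graph) exists_solution:
  assumes "demands U F"
  shows "\<exists>T. solution U F T \<and> int (card T) \<le> bound U F"
  using assms
proof (induction "card U" arbitrary: U F rule: less_induct)
  case less
  show ?case
  proof (rule ccontr)
    assume n: "\<not> ?case"
    interpret minimal_counterexample adj U F
    proof
      show "demands U F" by fact
      show "\<exists>T. solution U' F' T \<and> int (card T) \<le> bound U' F'"
        if "card U' < card U" "demands U' F'" for U' F'
        using less.hyps[OF that] .
      show "bound U F < int (card T)" if "solution U F T" for T
        using n that by (meson not_le)
    qed
    show False by (rule contradiction)
  qed
qed

section \<open>Clique transversals\<close>

lemma (in pair_graph) clique_iff:
  "clique G C \<longleftrightarrow> C \<subseteq> pverts G \<and> simple_graph.clq (\<lambda>x y. (x, y) \<in> parcs G) C"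
proof -
  interpret s: simple_graph "\<lambda>x y. (x, y) \<in> parcs G"
    by (rule simple_graph_parcs)
  let ?H = "\<lparr>pverts = C, parcs = {e \<in> parcs G. fst e \<in> C \<and> snd e \<in> C}\<rparr>"
  have "with_proj G \<restriction> C = with_proj ?H"
    by (simp add: induce_subgraph_def with_proj_def)
  then have "K\<^bsub>card C\<^esub> (with_proj G \<restriction> C) \<longleftrightarrow> finite C \<and>
      parcs ?H = {(u, v). (u, v) \<in> C \<times> C \<and> u \<noteq> v}"
    by (simp only: complete_digraph_pair_def) simp
  moreover have "parcs ?H = {(u, v). (u, v) \<in> C \<times> C \<and> u \<noteq> v} \<longleftrightarrow> s.clq C"
    using no_loops' by (auto simp: s.clq_def)
  ultimately have "K\<^bsub>card C\<^esub> (with_proj G \<restriction> C) \<longleftrightarrow> finite C \<and> s.clq C"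
    by blast
  moreover have "finite C" if "C \<subseteq> pverts G"
    using that pair_finite_verts by (rule finite_subset)
  ultimately show ?thesis unfolding clique_def by blast
qed

theorem theorem10:
  fixes G :: "'a pair_pre_digraph"
  assumes "pair_graph G" and "pverts G \<noteq> {}"
    and "four_chordal G"
    and "\<not> (\<exists>C. maximal_clique G C \<and> card C = 3)"
    and "card (pverts G) \<noteq> 4"
  shows "\<exists>T. clique_transversal G T \<and>
           real (card T) \<le> 2 * (real (card (pverts G)) - 1) / 7"
proof -
  interpret pair_graph G by fact
  interpret hole_free_graph "\<lambda>x y. (x, y) \<in> parcs G"
    using assms(3) by (intro chordal_imp_hole_free) (simp add: four_chordal_def)
  let ?n = "card (pverts G)"
  have n: "0 < ?n" using assms(2) by (simp add: card_gt_0_iff)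
  have "demands (pverts G) {}" by (simp add: demands_def)
  then obtain T where T: "solution (pverts G) {} T" "int (card T) \<le> bound (pverts G) {}"
    using exists_solution by blast
  have "clique_transversal G T"
    unfolding clique_transversal_def
  proof (intro conjI allI impI)
    show "T \<subseteq> pverts G" using T(1) by (simp add: solution_def)
    fix C assume C: "maximal_clique G C \<and> 2 \<le> card C"
    then have cl: "C \<subseteq> pverts G" "clq C" by (auto simp: maximal_clique_def clique_iff)
    have max: "K = C" if "clique G K" "C \<subseteq> K" for K
      using C that by (simp add: maximal_clique_def)
    \<comment> \<open>Sizes 2 and 3 are excluded by the 4-clique through each edge and by
      assumption, so \<open>C\<close> is a big clique.\<close>
    have "card C \<noteq> 2"
    proof
      assume 2: "card C = 2"
      then obtain u v where uv: "C = {u, v}" "u \<noteq> v" by (auto simp: card_2_iff)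
      then have "(u, v) \<in> parcs G" using cl by (simp add: clq_def)
      then obtain K where "clique G K" "card K = 4" "u \<in> K" "v \<in> K"
        using assms(3) by (auto simp: four_chordal_def)
      then show False using max[of K] uv 2 by simp
    qed
    moreover have "card C \<noteq> 3" using assms(4) C by blast
    ultimately have "4 \<le> card C" using C by linarith
    moreover have "\<exists>y\<in>C. (x, y) \<notin> parcs G" if "x \<in> pverts G - C" for x
    proof (rule ccontr)
      assume "\<not> ?thesis"
      then have "clq (insert x C)" using cl(2) by (intro clq_insert) auto
      then have "insert x C = C" using that cl(1) by (intro max) (auto simp: clique_iff)
      then show False using that by blast
    qed
    ultimately have "big_clique (pverts G) C" using cl by (simp add: big_clique_def)
    then show "T \<inter> C \<noteq> {}" using T(1) by (auto simp: solution_def)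
  qed
  moreover have "real (card T) \<le> 2 * (real ?n - 1) / 7"
  proof -
    \<comment> \<open>The number of vertices is positive and not 4, which selects the last branch of
      \<open>beta\<close>.\<close>
    have "bound (pverts G) {} = (2 * int ?n - 2) div 7"
      using n assms(2,5) by (simp add: bound_def net_size_def beta_def)
    then have "7 * int (card T) \<le> 2 * int ?n - 2" using T(2) by linarith
    then have "real_of_int (7 * int (card T)) \<le> real_of_int (2 * int ?n - 2)"
      by (simp only: of_int_le_iff)
    then show ?thesis by simp
  qed
  ultimately show ?thesis by blast
qed

end
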